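(* There is a large enough constant $C>0$ such that the following holds. Let $f\colon\{0,1\}^n\to\{0,1\}$ and $g\colon\{0,1\}^m\to\{0,1\}$ be Boolean functions, let $t\geq C\log n$, and let $\mathsf{Amp}_t\colon\{0,1\}^t\to\{0,1\}$ be any Boolean function with full sign degree. Then $\widetilde{\deg}(f\circ g)=\Omega(\widetilde{\deg}(f)\,\widetilde{\deg}(g))$ whenever $f=\mathsf{Amp}_t^d$ (and $g$ is arbitrary) or $g=\mathsf{Amp}_t^d$ (and $f$ is arbitrary), for a positive integer $d$.
   Context: For Boolean $F$ on $a$ bits and $G$ on $b$ bits, $F\circ G(x_1,\dots,x_a)=F(G(x_1),\dots,G(x_a))$; $F^d$ is $F$ composed with itself $d$ times. $\widetilde{\deg}(F)$ is the minimum degree of a real polynomial $p$ with $|p(x)-F(x)|\leq 1/3$ on all Boolean inputs. The sign degree of $F$ is the minimum degree of a real polynomial $p$ with $(1-2F(x))p(x)>0$ for all Boolean $x$; full sign degree means sign degree equal to the number of input bits $t$. *)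

theory Defs
  imports Complex_Main "HOL-Library.Poly_Mapping"
begin

text \<open>
  A Boolean function on \<open>n\<close> bits is a function \<open>F :: bool list \<Rightarrow> bool\<close> together with \<open>n\<close>;
  only its values on lists of length \<open>n\<close> are ever used.
\<close>

definition cube :: "nat \<Rightarrow> bool list set" where
  "cube n = {x. length x = n}"

text \<open>
  Real polynomials in variables indexed by \<^typ>\<open>nat\<close>: a monomial is a finitely supported
  exponent vector, a polynomial a finitely supported map from monomials to coefficients.
\<close>

type_synonym real_mpoly = "(nat \<Rightarrow>\<^sub>0 nat) \<Rightarrow>\<^sub>0 real"

definition mp_vars :: "real_mpoly \<Rightarrow> nat set" where
  "mp_vars p = (\<Union>\<mu>\<in>Poly_Mapping.keys p. Poly_Mapping.keys \<mu>)"

text \<open>Total degree, with degree \<open>0\<close> for the zero polynomial.\<close>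

definition mp_degree :: "real_mpoly \<Rightarrow> nat" where
  "mp_degree p =
     Max (insert 0 ((\<lambda>\<mu>. \<Sum>i\<in>Poly_Mapping.keys \<mu>. Poly_Mapping.lookup \<mu> i) ` Poly_Mapping.keys p))"

definition mp_eval :: "real_mpoly \<Rightarrow> (nat \<Rightarrow> real) \<Rightarrow> real" where
  "mp_eval p v =
     (\<Sum>\<mu>\<in>Poly_Mapping.keys p.
        Poly_Mapping.lookup p \<mu> * (\<Prod>i\<in>Poly_Mapping.keys \<mu>. v i ^ Poly_Mapping.lookup \<mu> i))"

definition mp_eval_bits :: "real_mpoly \<Rightarrow> bool list \<Rightarrow> real" where
  "mp_eval_bits p x = mp_eval p (\<lambda>i. of_bool (x ! i))"

definition approx_degree :: "nat \<Rightarrow> (bool list \<Rightarrow> bool) \<Rightarrow> nat" where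
  "approx_degree n F =
     (LEAST k. \<exists>p. mp_vars p \<subseteq> {..<n} \<and> mp_degree p = k \<and>
        (\<forall>x\<in>cube n. \<bar>mp_eval_bits p x - of_bool (F x)\<bar> \<le> 1 / 3))"

definition sign_degree :: "nat \<Rightarrow> (bool list \<Rightarrow> bool) \<Rightarrow> nat" where
  "sign_degree n F =
     (LEAST k. \<exists>p. mp_vars p \<subseteq> {..<n} \<and> mp_degree p = k \<and>
        (\<forall>x\<in>cube n. (1 - 2 * of_bool (F x)) * mp_eval_bits p x > 0))"

text \<open>
  Block composition of \<open>F\<close> on \<open>a\<close> bits with \<open>G\<close> on \<open>b\<close> bits, a Boolean function on \<open>a * b\<close> bits:
  the input is cut into \<open>a\<close> consecutive blocks of \<open>b\<close> bits.
\<close>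

definition bcomp ::
    "nat \<Rightarrow> nat \<Rightarrow> (bool list \<Rightarrow> bool) \<Rightarrow> (bool list \<Rightarrow> bool) \<Rightarrow> bool list \<Rightarrow> bool" where
  "bcomp a b F G x = F (map (\<lambda>i. G (take b (drop (i * b) x))) [0..<a])"

text \<open>
  \<open>bpow a F d\<close> is the \<open>d\<close>-fold composition of \<open>F\<close> with itself, a Boolean function on \<open>a ^ d\<close> bits.
  The recursion starts from the identity on one bit, so that \<open>bpow a F 1\<close> is \<open>F\<close>.
\<close>

primrec bpow :: "nat \<Rightarrow> (bool list \<Rightarrow> bool) \<Rightarrow> nat \<Rightarrow> bool list \<Rightarrow> bool" where
  "bpow a F 0 = hd"
| "bpow a F (Suc d) = bcomp a (a ^ d) F (bpow a F d)"

lemma bpow_1: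
  assumes "x \<in> cube a"
  shows "bpow a F 1 x = F x"
proof -
  have len: "length x = a"
    using assms by (simp add: cube_def)
  have "map (\<lambda>i. hd (take 1 (drop (i * 1) x))) [0..<a] = x"
    using len by (intro nth_equalityI) (auto simp: hd_drop_conv_nth)
  then show ?thesis
    by (simp add: bcomp_def)
qed

end

theory Submission
  imports Defs
begin

text \<open>
  By linear programming duality, full sign degree forces a measure on the cube that is orthogonal
  to every polynomial of degree \<open>t - 1\<close>; testing it on edges shows that \<open>Amp\<close> is the parity function
  or its negation, and hence so is every power of it.

  If \<open>g\<close> is a parity, average an approximant of \<open>f \<circ> g\<close> over the uniform distribution on the
  fibre of each input of \<open>f\<close>: only characters that are unions of full blocks survive, so the degree
  drops by a factor of \<open>m\<close>.

  If \<open>f\<close> is a parity, take a dual witness \<open>\<psi>\<close> of pure high degree \<open>d\<close> whose correlation with \<open>g\<close> is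
  a constant close to \<open>1\<close>, and let \<open>Z\<close> be the set of blocks where \<open>\<psi>\<close> has the wrong sign. The
  product of the \<open>\<psi>\<close>'s has sign \<open>(f \<circ> g) * (-1) ^ card Z\<close>; multiplying it by the truncation to
  degree \<open>n / 2\<close> of the expansion of \<open>(-1) ^ card Z\<close> corrects the sign whenever \<open>card Z \<le> n / 2\<close>,
  which holds outside a set of tiny weight, and still leaves \<open>n / 2\<close> factors \<open>\<psi>\<close> intact, so the pure
  high degree is at least \<open>n / 2 * d\<close>. Passing from correlation close to \<open>1\<close> to error \<open>1 / 3\<close> costs
  a constant factor in the degree.
\<close>

subsection \<open>Functions of bounded degree on the cube\<close>

definition sgnb :: "bool \<Rightarrow> real" where
  "sgnb b = 1 - 2 * of_bool b"

lemma sgnb_simps [simp]: "sgnb True = - 1" "sgnb False = 1"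
  by (auto simp: sgnb_def)

lemma sgnb_Not: "sgnb (\<not> b) = - sgnb b"
  by (cases b) auto

lemma abs_sgnb [simp]: "\<bar>sgnb b\<bar> = 1"
  by (cases b) auto

text \<open>The parity function in sign form: the Fourier character of the set of all
  coordinates.\<close>

definition chi :: "bool list \<Rightarrow> real" where
  "chi x = prod_list (map sgnb x)"

lemma chi_append [simp]: "chi (x @ y) = chi x * chi y"
  by (simp add: chi_def)

lemma abs_chi [simp]: "\<bar>chi x\<bar> = 1"
  by (induction x) (auto simp: chi_def abs_mult)

lemma chi_cases: "chi x = 1 \<or> chi x = - 1"
  using abs_chi[of x] by linarith

lemma chi_flip:
  assumes "j < length x"
  shows "chi (x[j := \<not> x ! j]) = - chi x"
proof -
  have "chi (x[j := \<not> x ! j]) = chi (take j x @ [\<not> x ! j] @ drop (Suc j) x)"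
    using assms by (simp add: upd_conv_take_nth_drop)
  also have "\<dots> = - chi (take j x @ [x ! j] @ drop (Suc j) x)"
    by (simp only: chi_append) (simp add: chi_def sgnb_Not)
  also have "take j x @ [x ! j] @ drop (Suc j) x = x"
    using assms by (simp add: id_take_nth_drop[symmetric])
  finally show ?thesis .
qed

section \<open>Multilinear monomials and their span in bounded degree\<close>

definition mon :: "nat set \<Rightarrow> bool list \<Rightarrow> real" where
  "mon S x = of_bool (\<forall>i\<in>S. x ! i)"

lemma mon_empty [simp]: "mon {} x = 1"
  by (simp add: mon_def)

lemma mon_mult: "mon S x * mon T x = mon (S \<union> T) x"
  by (auto simp: mon_def)

lemma of_bool_Ball: "finite A \<Longrightarrow> of_bool (\<forall>i\<in>A. P i) = (\<Prod>i\<in>A. of_bool (P i) :: real)"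
  by (induction A rule: finite_induct) auto

lemma finite_cube [simp]: "finite (cube n)"
  using finite_lists_length_eq[of "UNIV :: bool set" n] by (simp add: cube_def)

text \<open>The linear span of the multilinear monomials of degree at most \<open>k\<close>. The
  rule \<open>cong\<close> makes values off the cube irrelevant. Linear statements follow by
  induction from the case of one monomial.\<close>

inductive bool_poly :: "nat \<Rightarrow> nat \<Rightarrow> (bool list \<Rightarrow> real) \<Rightarrow> bool" for n k where
  mon: "S \<subseteq> {..<n} \<Longrightarrow> card S \<le> k \<Longrightarrow> bool_poly n k (mon S)"
| add: "bool_poly n k \<phi> \<Longrightarrow> bool_poly n k \<psi> \<Longrightarrow> bool_poly n k (\<lambda>x. \<phi> x + \<psi> x)"
| scale: "bool_poly n k \<phi> \<Longrightarrow> bool_poly n k (\<lambda>x. a * \<phi> x)"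
| cong: "bool_poly n k \<phi> \<Longrightarrow> (\<And>x. x \<in> cube n \<Longrightarrow> \<psi> x = \<phi> x) \<Longrightarrow> bool_poly n k \<psi>"

lemma bool_poly_const: "bool_poly n k (\<lambda>x. a)"
  using bool_poly.scale[OF bool_poly.mon[of "{}" n k], of a] by simp

lemma bool_poly_diff:
  "bool_poly n k \<phi> \<Longrightarrow> bool_poly n k \<psi> \<Longrightarrow> bool_poly n k (\<lambda>x. \<phi> x - \<psi> x)"
  using bool_poly.add[of n k \<phi> "\<lambda>x. - 1 * \<psi> x"] bool_poly.scale[of n k \<psi> "- 1"] by simp

lemma bool_poly_sum:
  "finite A \<Longrightarrow> (\<And>a. a \<in> A \<Longrightarrow> bool_poly n k (\<phi> a)) \<Longrightarrow> bool_poly n k (\<lambda>x. \<Sum>a\<in>A. \<phi> a x)"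
proof (induction A rule: finite_induct)
  case empty
  show ?case by (simp add: bool_poly_const)
next
  case (insert a A)
  then show ?case by (simp add: bool_poly.add)
qed

lemma bool_poly_mono: "bool_poly n k \<phi> \<Longrightarrow> k \<le> l \<Longrightarrow> bool_poly n l \<phi>"
proof (induction rule: bool_poly.induct)
  case (mon S)
  then show ?case by (intro bool_poly.mon) auto
next
  case (cong \<phi> \<psi>)
  then show ?case using bool_poly.cong by blast
qed (auto intro: bool_poly.add bool_poly.scale)

text \<open>Bilinearity reduces this to two monomials, whose product is the monomial of the union of
  their index sets.\<close>

lemma bool_poly_mult:
  assumes "bool_poly n k \<phi>" "bool_poly n l \<psi>"
  shows "bool_poly n (k + l) (\<lambda>x. \<phi> x * \<psi> x)"
  using assms(1)
proof (induction rule: bool_poly.induct)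
  case S: (mon S)
  show ?case
    using assms(2)
  proof (induction rule: bool_poly.induct)
    case (mon T)
    have "card (S \<union> T) \<le> k + l"
      using card_Un_le[of S T] S mon by linarith
    then show ?case
      using S mon by (auto simp: mon_mult intro!: bool_poly.mon)
  next
    case (add \<phi> \<psi>)
    then show ?case by (auto simp: distrib_left intro: bool_poly.add)
  next
    case (scale \<phi> a)
    then show ?case using bool_poly.scale[OF scale.IH, of a] by (simp add: mult_ac)
  next
    case (cong \<phi> \<psi>)
    then show ?case by (intro bool_poly.cong[OF cong.IH]) simp
  qed
next
  case (add \<phi> \<psi>)
  then show ?case by (auto simp: distrib_right intro: bool_poly.add)
next
  case (scale \<phi> a)
  then show ?case using bool_poly.scale[OF scale.IH, of a] by (simp add: mult_ac)
next
  case (cong \<phi> \<psi>)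
  then show ?case by (intro bool_poly.cong[OF cong.IH]) simp
qed

lemma bool_poly_prod:
  "finite A \<Longrightarrow> (\<And>a. a \<in> A \<Longrightarrow> bool_poly n 1 (\<phi> a)) \<Longrightarrow> bool_poly n (card A) (\<lambda>x. \<Prod>a\<in>A. \<phi> a x)"
proof (induction A rule: finite_induct)
  case (insert a A)
  then show ?case using bool_poly_mult[of n 1 "\<phi> a" "card A"] by simp
qed (simp add: bool_poly_const)

lemma bool_poly_bit: "i < n \<Longrightarrow> bool_poly n 1 (\<lambda>x. of_bool (x ! i))"
  using bool_poly.mon[of "{i}" n 1] by (simp add: mon_def[abs_def])

lemma bool_poly_sgnb: "i < n \<Longrightarrow> bool_poly n 1 (\<lambda>x. sgnb (x ! i))"
  unfolding sgnb_def by (intro bool_poly_diff bool_poly_const bool_poly.scale bool_poly_bit)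

lemma bool_poly_eq_bit: "i < n \<Longrightarrow> bool_poly n 1 (\<lambda>x. of_bool (x ! i = b))"
proof -
  assume i: "i < n"
  have "of_bool (x ! i = b) = (1 + sgnb b * sgnb (x ! i)) / 2" for x :: "bool list"
    by (cases b; cases "x ! i") auto
  moreover have "bool_poly n 1 (\<lambda>x. (1 / 2) * (1 + sgnb b * sgnb (x ! i)))"
    using i by (intro bool_poly.add bool_poly_const bool_poly.scale bool_poly_sgnb)
  ultimately show ?thesis by (simp only: times_divide_eq_left mult_1)
qed

text \<open>The indicator of a subcube is a product of one affine factor per fixed coordinate.
  Fixing all coordinates serves interpolation; fixing all but one gives the edges of the
  cube.\<close>

lemma bool_poly_all_eq:
  assumes "A \<subseteq> {..<n}"
  shows "bool_poly n (card A) (\<lambda>x. of_bool (\<forall>i\<in>A. x ! i = a ! i))"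
proof -
  have fin: "finite A" using assms by (rule finite_subset) simp
  show ?thesis
    unfolding of_bool_Ball[OF fin]
    using bool_poly_prod[OF fin, of n "\<lambda>i x. of_bool (x ! i = a ! i)"] bool_poly_eq_bit assms by auto
qed

lemma bool_poly_full: "bool_poly n n \<phi>"
proof -
  have "bool_poly n n (\<lambda>x. \<Sum>a\<in>cube n. \<phi> a * of_bool (\<forall>i\<in>{..<n}. x ! i = a ! i))"
    using bool_poly_all_eq[of "{..<n}" n] by (intro bool_poly_sum finite_cube bool_poly.scale) auto
  then show ?thesis
  proof (rule bool_poly.cong)
    fix x assume x: "x \<in> cube n"
    have "(\<forall>i\<in>{..<n}. x ! i = a ! i) \<longleftrightarrow> a = x" if "a \<in> cube n" for a
      using x that by (auto simp: cube_def intro: nth_equalityI)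
    then have "(\<Sum>a\<in>cube n. \<phi> a * of_bool (\<forall>i\<in>{..<n}. x ! i = a ! i))
        = (\<Sum>a\<in>cube n. if a = x then \<phi> a else 0)"
      by (intro sum.cong) auto
    then show "\<phi> x = (\<Sum>a\<in>cube n. \<phi> a * of_bool (\<forall>i\<in>{..<n}. x ! i = a ! i))"
      using x by simp
  qed
qed

subsection \<open>Relation to formal polynomials\<close>

lemma mp_eval_superset:
  assumes "finite K" "Poly_Mapping.keys p \<subseteq> K"
  shows "mp_eval p v =
    (\<Sum>\<mu>\<in>K. Poly_Mapping.lookup p \<mu> * (\<Prod>i\<in>Poly_Mapping.keys \<mu>. v i ^ Poly_Mapping.lookup \<mu> i))"
  unfolding mp_eval_def using assms by (intro sum.mono_neutral_left) (auto simp: in_keys_iff)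

lemma mp_eval_add: "mp_eval (p + q) v = mp_eval p v + mp_eval q v"
proof -
  let ?K = "Poly_Mapping.keys p \<union> Poly_Mapping.keys q"
  have "Poly_Mapping.keys (p + q) \<subseteq> ?K" by (rule Poly_Mapping.keys_add)
  then show ?thesis
    by (simp add: mp_eval_superset[of ?K] lookup_add distrib_right sum.distrib)
qed

lemma keys_map_times: "Poly_Mapping.keys (Poly_Mapping.map ((*) (a::real)) p) \<subseteq> Poly_Mapping.keys p"
  by (auto simp: in_keys_iff map.rep_eq when_def)

lemma mp_eval_scale: "mp_eval (Poly_Mapping.map ((*) a) p) v = a * mp_eval p v"
  by (auto simp: mp_eval_superset[OF _ keys_map_times] mp_eval_def[of p] sum_distrib_left mult.assoc
      map.rep_eq in_keys_iff when_def intro!: sum.cong)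

lemma mp_degree_le_iff:
  "mp_degree p \<le> k \<longleftrightarrow>
    (\<forall>\<mu>\<in>Poly_Mapping.keys p. (\<Sum>i\<in>Poly_Mapping.keys \<mu>. Poly_Mapping.lookup \<mu> i) \<le> k)"
  by (simp add: mp_degree_def)

text \<open>Positive powers of a bit equal the bit, so a formal monomial acts on the cube through
  its support alone, and the size of the support is at most the degree.\<close>

lemma bool_poly_mp:
  assumes "mp_vars p \<subseteq> {..<n}" "mp_degree p \<le> k"
  shows "bool_poly n k (mp_eval_bits p)"
proof -
  have "bool_poly n k (\<lambda>x. \<Sum>\<mu>\<in>Poly_Mapping.keys p. Poly_Mapping.lookup p \<mu> * mon (Poly_Mapping.keys \<mu>) x)"
  proof (intro bool_poly_sum finite_keys bool_poly.scale bool_poly.mon)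
    fix \<mu> assume \<mu>: "\<mu> \<in> Poly_Mapping.keys p"
    then show "Poly_Mapping.keys \<mu> \<subseteq> {..<n}"
      using assms(1) by (auto simp: mp_vars_def)
    have "card (Poly_Mapping.keys \<mu>) = (\<Sum>i\<in>Poly_Mapping.keys \<mu>. 1)" by simp
    also have "\<dots> \<le> (\<Sum>i\<in>Poly_Mapping.keys \<mu>. Poly_Mapping.lookup \<mu> i)"
      by (intro sum_mono) (simp add: in_keys_iff)
    also have "\<dots> \<le> k" using assms(2) \<mu> by (simp add: mp_degree_le_iff)
    finally show "card (Poly_Mapping.keys \<mu>) \<le> k" .
  qed
  then show ?thesis
  proof (rule bool_poly.cong)
    fix x
    have "(\<Prod>i\<in>Poly_Mapping.keys \<mu>. of_bool (x ! i) ^ Poly_Mapping.lookup \<mu> i) = mon (Poly_Mapping.keys \<mu>) x"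
      for \<mu>
      unfolding mon_def of_bool_Ball[OF finite_keys] by (intro prod.cong) (auto simp: in_keys_iff)
    then show "mp_eval_bits p x =
      (\<Sum>\<mu>\<in>Poly_Mapping.keys p. Poly_Mapping.lookup p \<mu> * mon (Poly_Mapping.keys \<mu>) x)"
      by (simp add: mp_eval_bits_def mp_eval_def)
  qed
qed

lemma bool_poly_imp_mp:
  assumes "bool_poly n k \<phi>"
  shows "\<exists>p. mp_vars p \<subseteq> {..<n} \<and> mp_degree p \<le> k \<and> (\<forall>x\<in>cube n. mp_eval_bits p x = \<phi> x)"
  using assms
proof (induction rule: bool_poly.induct)
  case (mon S)
  have fin: "finite S" using mon(1) by (rule finite_subset) simp
  define \<mu> :: "nat \<Rightarrow>\<^sub>0 nat" where "\<mu> = Abs_poly_mapping (\<lambda>i. of_bool (i \<in> S))"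
  have lookup: "Poly_Mapping.lookup \<mu> i = of_bool (i \<in> S)" for i
    unfolding \<mu>_def using fin by (simp add: lookup_Abs_poly_mapping)
  have keys: "Poly_Mapping.keys \<mu> = S"
    by (auto simp: in_keys_iff lookup)
  let ?p = "Poly_Mapping.single \<mu> (1::real)"
  have "mp_vars ?p \<subseteq> {..<n}" using mon by (simp add: mp_vars_def keys)
  moreover have "mp_degree ?p \<le> k" using mon by (simp add: mp_degree_le_iff keys lookup)
  moreover have "mp_eval_bits ?p x = mon S x" for x
    by (simp add: mp_eval_bits_def mp_eval_def keys lookup mon_def of_bool_Ball[OF fin])
  ultimately show ?case by blast
next
  case (add \<phi> \<psi>)
  then obtain p q where
    "mp_vars p \<subseteq> {..<n}" "mp_degree p \<le> k" "\<forall>x\<in>cube n. mp_eval_bits p x = \<phi> x"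
    "mp_vars q \<subseteq> {..<n}" "mp_degree q \<le> k" "\<forall>x\<in>cube n. mp_eval_bits q x = \<psi> x" by blast
  moreover have "Poly_Mapping.keys (p + q) \<subseteq> Poly_Mapping.keys p \<union> Poly_Mapping.keys q"
    by (rule Poly_Mapping.keys_add)
  ultimately show ?case
    by (intro exI[of _ "p + q"]) (fastforce simp: mp_vars_def mp_degree_le_iff mp_eval_bits_def mp_eval_add)
next
  case (scale \<phi> a)
  then obtain p where
    "mp_vars p \<subseteq> {..<n}" "mp_degree p \<le> k" "\<forall>x\<in>cube n. mp_eval_bits p x = \<phi> x" by blast
  then show ?case
    using keys_map_times[of a p]
    by (intro exI[of _ "Poly_Mapping.map ((*) a) p"])
      (fastforce simp: mp_vars_def mp_degree_le_iff mp_eval_bits_def mp_eval_scale)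
next
  case (cong \<phi> \<psi>)
  then show ?case by auto
qed

lemma approx_degree_le:
  assumes "bool_poly n k \<phi>" "\<And>x. x \<in> cube n \<Longrightarrow> \<bar>\<phi> x - of_bool (F x)\<bar> \<le> 1 / 3"
  shows "approx_degree n F \<le> k"
proof -
  obtain p where p: "mp_vars p \<subseteq> {..<n}" "mp_degree p \<le> k" "\<forall>x\<in>cube n. mp_eval_bits p x = \<phi> x"
    using bool_poly_imp_mp[OF assms(1)] by blast
  have "approx_degree n F \<le> mp_degree p"
    unfolding approx_degree_def using p assms(2)
    by (intro Least_le exI[of _ p] conjI refl ballI) (simp_all only: p)
  with p(2) show ?thesis by linarith
qed

text \<open>Exact interpolation provides a candidate, so the \<open>LEAST\<close> in
  \<open>approx_degree\<close> is over a nonempty set and is attained.\<close>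

lemma approx_degree_attained:
  obtains \<phi> where "bool_poly n (approx_degree n F) \<phi>"
    "\<And>x. x \<in> cube n \<Longrightarrow> \<bar>\<phi> x - of_bool (F x)\<bar> \<le> 1 / 3"
proof -
  let ?Q = "\<lambda>k. \<exists>p. mp_vars p \<subseteq> {..<n} \<and> mp_degree p = k \<and>
        (\<forall>x\<in>cube n. \<bar>mp_eval_bits p x - of_bool (F x)\<bar> \<le> 1 / 3)"
  obtain p where "mp_vars p \<subseteq> {..<n}" "\<forall>x\<in>cube n. mp_eval_bits p x = of_bool (F x)"
    using bool_poly_imp_mp[OF bool_poly_full[of n "\<lambda>x. of_bool (F x)"]] by blast
  then have "?Q (mp_degree p)" by (intro exI[of _ p]) simp
  then have "?Q (approx_degree n F)" unfolding approx_degree_def by (rule LeastI)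
  then obtain q where q: "mp_vars q \<subseteq> {..<n}" "mp_degree q = approx_degree n F"
    "\<forall>x\<in>cube n. \<bar>mp_eval_bits q x - of_bool (F x)\<bar> \<le> 1 / 3" by blast
  show ?thesis
    using that[OF bool_poly_mp[OF q(1)]] q(2,3) by simp
qed

lemma approx_degree_le_arity: "approx_degree n F \<le> n"
  by (rule approx_degree_le[OF bool_poly_full[of n "\<lambda>x. of_bool (F x)"]]) simp

lemma sign_degree_le:
  assumes "bool_poly n k \<phi>" "\<And>x. x \<in> cube n \<Longrightarrow> sgnb (F x) * \<phi> x > 0"
  shows "sign_degree n F \<le> k"
proof -
  obtain p where p: "mp_vars p \<subseteq> {..<n}" "mp_degree p \<le> k" "\<forall>x\<in>cube n. mp_eval_bits p x = \<phi> x"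
    using bool_poly_imp_mp[OF assms(1)] by blast
  have "sign_degree n F \<le> mp_degree p"
    unfolding sign_degree_def sgnb_def[symmetric] using p assms(2)
    by (intro Least_le exI[of _ p] conjI refl ballI) (simp_all only: p)
  with p(2) show ?thesis by linarith
qed

subsection \<open>Duality\<close>

text \<open>Gordan's theorem of the alternative for a linear space of functions on a finite set, by
  removing one point \<open>a\<close> at a time. It is the only form of linear programming duality
  used below.\<close>

lemma gordan:
  fixes W :: "('a \<Rightarrow> real) set"
  assumes "finite X"
    and zero: "(\<lambda>x. 0) \<in> W"
    and add: "\<And>u v. u \<in> W \<Longrightarrow> v \<in> W \<Longrightarrow> (\<lambda>x. u x + v x) \<in> W"
    and scale: "\<And>a u. u \<in> W \<Longrightarrow> (\<lambda>x. a * u x) \<in> W"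
    and no_pos: "\<not> (\<exists>w\<in>W. \<forall>x\<in>X. w x > 0)"
  obtains \<mu> where "\<And>x. x \<in> X \<Longrightarrow> \<mu> x \<ge> 0" "\<exists>x\<in>X. \<mu> x > 0" "\<And>w. w \<in> W \<Longrightarrow> (\<Sum>x\<in>X. \<mu> x * w x) = 0"
proof -
  have "\<exists>\<mu>. (\<forall>x\<in>X. \<mu> x \<ge> 0) \<and> (\<exists>x\<in>X. \<mu> x > 0) \<and> (\<forall>w\<in>W. (\<Sum>x\<in>X. \<mu> x * w x) = 0)"
    using assms
  proof (induction X arbitrary: W rule: finite_induct)
    case empty
    then show ?case by auto
  next
    case (insert a X)
    note W = insert.prems
    have upd: "(\<Sum>x\<in>X. (\<mu>(a := r)) x * w x) = (\<Sum>x\<in>X. \<mu> x * w x)" for \<mu> w :: "'a \<Rightarrow> real" and r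
      using insert.hyps by (intro sum.cong) auto
    show ?case
    proof (cases "\<exists>w\<in>W. \<forall>x\<in>X. w x > 0")
      case False
      then obtain \<mu> where \<mu>: "\<forall>x\<in>X. \<mu> x \<ge> 0" "\<exists>x\<in>X. \<mu> x > 0" "\<forall>w\<in>W. (\<Sum>x\<in>X. \<mu> x * w x) = 0"
        using insert.IH[of W] W by blast
      have "\<exists>x\<in>X. (\<mu>(a := 0)) x > 0"
        using \<mu>(2) insert.hyps(2) by auto
      then show ?thesis
        using \<mu>(1,3) insert.hyps by (intro exI[of _ "\<mu>(a := 0)"]) (auto simp: upd simp del: fun_upd_apply, auto)
    next
      case True
      then obtain w0 where w0: "w0 \<in> W" "\<forall>x\<in>X. w0 x > 0" by blast
      have w0a: "w0 a \<le> 0"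
      proof (rule ccontr)
        assume "\<not> w0 a \<le> 0"
        then have "\<forall>x\<in>insert a X. w0 x > 0" using w0(2) by simp
        then show False using W(4) w0(1) by blast
      qed
      show ?thesis
      proof (cases "\<exists>u\<in>W. u a \<noteq> 0")
        case False
        then show ?thesis
          \<comment> \<open>All of \<open>W\<close> vanishes at \<open>a\<close>, so the point mass
            at \<open>a\<close> is orthogonal to it.\<close>
          using insert.hyps
          by (intro exI[of _ "(\<lambda>_. 0)(a := 1)"]) (simp add: upd del: fun_upd_apply, simp)
      next
        case True
        then obtain u0 where u0: "u0 \<in> W" "u0 a \<noteq> 0" by blast
        define u where "u = (\<lambda>x. (1 / u0 a) * u0 x)"
        have u: "u \<in> W" "u a = 1"
          unfolding u_def by (rule W(3)[OF u0(1)]) (simp add: u0(2))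
        let ?W = "{w \<in> W. w a = 0}"
        \<comment> \<open>If \<open>w\<close> vanishes at \<open>a\<close> and is positive on
          \<open>X\<close>, adding a small multiple of \<open>u\<close> makes it positive at
          \<open>a\<close> as well; \<open>e\<close> is chosen so that positivity on
          \<open>X\<close> survives.\<close>
        have "\<not> (\<exists>w\<in>?W. \<forall>x\<in>X. w x > 0)"
        proof
          assume "\<exists>w\<in>?W. \<forall>x\<in>X. w x > 0"
          then obtain w where w: "w \<in> W" "w a = 0" "\<forall>x\<in>X. w x > 0" by blast
          define e where "e = Min (insert 1 ((\<lambda>x. w x / (1 + \<bar>u x\<bar>)) ` X)) / 2"
          have e0: "e > 0"
            using w(3) insert.hyps(1) by (auto simp: e_def divide_simps add_pos_nonneg)
          have "w x + e * u x > 0" if x: "x \<in> X" for x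
          proof -
            have "2 * e \<le> w x / (1 + \<bar>u x\<bar>)"
              using x insert.hyps(1) by (auto simp: e_def intro!: Min_le)
            then have "2 * e * (1 + \<bar>u x\<bar>) \<le> w x"
              by (simp add: pos_le_divide_eq add_pos_nonneg)
            moreover have "e * \<bar>u x\<bar> \<ge> - (e * u x)"
              using e0 by (simp add: abs_if)
            moreover have "2 * e * (1 + \<bar>u x\<bar>) = 2 * e + 2 * (e * \<bar>u x\<bar>)" by (simp add: algebra_simps)
            moreover have "e * \<bar>u x\<bar> \<ge> 0" using e0 by simp
            ultimately show ?thesis using e0 by linarith
          qed
          then have "\<forall>x\<in>insert a X. w x + e * u x > 0"
            using w(2) u(2) e0 by auto
          then have "\<exists>w\<in>W. \<forall>x\<in>insert a X. w x > 0"
            using W(2)[OF w(1) W(3)[OF u(1), of e]]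
            by (intro bexI[where x = "\<lambda>x. w x + e * u x"]) simp_all
          then show False using W(4) by blast
        qed
        then obtain \<mu> where \<mu>: "\<forall>x\<in>X. \<mu> x \<ge> 0" "\<exists>x\<in>X. \<mu> x > 0" "\<forall>w\<in>?W. (\<Sum>x\<in>X. \<mu> x * w x) = 0"
          using insert.IH[of ?W] W(1-3) by auto
        define L where "L = (\<lambda>w :: 'a \<Rightarrow> real. \<Sum>x\<in>X. \<mu> x * w x)"
        \<comment> \<open>Subtracting \<open>w a\<close> times \<open>u\<close> lands in
          \<open>?W\<close>, where \<open>L\<close> vanishes. Hence \<open>L\<close> on
          \<open>W\<close> depends only on the value at \<open>a\<close>.\<close>
        have L: "L w = w a * L u" if "w \<in> W" for w
        proof -
          have "(\<lambda>x. w x + (- w a) * u x) \<in> ?W"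
            using W(2)[OF that W(3)[OF u(1), of "- w a"]] u(2) by simp
          then have "L (\<lambda>x. w x + (- w a) * u x) = 0"
            using bspec[OF \<mu>(3)] by (simp add: L_def)
          moreover have "L (\<lambda>x. w x + (- w a) * u x) = L w - w a * L u"
            by (simp add: L_def algebra_simps sum_subtractf sum_distrib_left)
          ultimately show ?thesis by simp
        qed
        obtain x where "x \<in> X" "\<mu> x > 0" using \<mu>(2) by blast
        then have "L w0 > 0"
          unfolding L_def using \<mu>(1) w0(2) insert.hyps(1)
          by (intro sum_pos2[of X x]) (simp_all add: less_imp_le)
        \<comment> \<open>Since \<open>w0 a \<le> 0\<close> and \<open>L w0 > 0\<close>, the weight
          \<open>- L u\<close> needed at \<open>a\<close> to cancel \<open>L\<close> is
          positive.\<close>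
        then have "L u < 0"
          using L[OF w0(1)] w0a by (simp add: zero_less_mult_iff)
        then have "\<forall>x\<in>insert a X. (\<mu>(a := - L u)) x \<ge> 0" "\<exists>x\<in>insert a X. (\<mu>(a := - L u)) x > 0"
          using \<mu>(1) by auto
        moreover have "\<forall>w\<in>W. (\<Sum>x\<in>insert a X. (\<mu>(a := - L u)) x * w x) = 0"
        proof
          fix w assume w: "w \<in> W"
          have "(\<Sum>x\<in>insert a X. (\<mu>(a := - L u)) x * w x) = - L u * w a + L w"
            by (simp only: sum.insert[OF insert.hyps] upd fun_upd_same L_def)
          then show "(\<Sum>x\<in>insert a X. (\<mu>(a := - L u)) x * w x) = 0"
            using L[OF w] by simp
        qed
        ultimately show ?thesis by blast
      qed
    qed
  qed
  then show ?thesis using that by blast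
qed

text \<open>Pure high degree at least \<open>d\<close>: orthogonality to all polynomials of degree
  below \<open>d\<close>, tested on monomials only.\<close>

definition pure_high :: "nat \<Rightarrow> nat \<Rightarrow> (bool list \<Rightarrow> real) \<Rightarrow> bool" where
  "pure_high n d \<eta> \<longleftrightarrow> (\<forall>S\<subseteq>{..<n}. card S < d \<longrightarrow> (\<Sum>x\<in>cube n. \<eta> x * mon S x) = 0)"

lemma pure_highI:
  assumes "\<And>\<phi> k. bool_poly n k \<phi> \<Longrightarrow> k < d \<Longrightarrow> (\<Sum>x\<in>cube n. \<eta> x * \<phi> x) = 0"
  shows "pure_high n d \<eta>"
  unfolding pure_high_def
proof (intro allI impI)
  fix S assume S: "S \<subseteq> {..<n}" "card S < d"
  show "(\<Sum>x\<in>cube n. \<eta> x * mon S x) = 0"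
    by (rule assms[OF bool_poly.mon[OF S(1) order_refl] S(2)])
qed

lemma pure_highD:
  assumes "pure_high n d \<eta>" "bool_poly n k \<phi>" "k < d"
  shows "(\<Sum>x\<in>cube n. \<eta> x * \<phi> x) = 0"
  using assms(2)
proof (induction rule: bool_poly.induct)
  case (mon S)
  then show ?case using assms(1,3) by (auto simp: pure_high_def)
next
  case (add \<phi> \<psi>)
  then show ?case by (simp add: distrib_left sum.distrib)
next
  case (scale \<phi> a)
  have "(\<Sum>x\<in>cube n. \<eta> x * (a * \<phi> x)) = a * (\<Sum>x\<in>cube n. \<eta> x * \<phi> x)"
    by (simp add: sum_distrib_left mult.left_commute)
  with scale.IH show ?case by simp
next
  case (cong \<phi> \<psi>)
  then show ?case by simp
qed

text \<open>Flipping a coordinate outside \<open>S\<close> negates \<open>chi\<close> and fixes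
  \<open>mon S\<close>, so the sum equals its own negative.\<close>

lemma pure_high_chi: "pure_high n n chi"
  unfolding pure_high_def
proof (intro allI impI)
  fix S assume S: "S \<subseteq> {..<n}" "card S < n"
  have "S \<noteq> {..<n}" using S(2) by auto
  then obtain j where j: "j < n" "j \<notin> S" using S(1) by blast
  let ?flip = "\<lambda>x. x[j := \<not> x ! j]"
  have bij: "bij_betw ?flip (cube n) (cube n)"
    using j by (intro bij_betw_byWitness[where f' = ?flip]) (auto simp: cube_def)
  have "(\<Sum>x\<in>cube n. chi x * mon S x) = (\<Sum>x\<in>cube n. chi (?flip x) * mon S (?flip x))"
    by (rule sum.reindex_bij_betw[OF bij, symmetric])
  also have "\<dots> = (\<Sum>x\<in>cube n. - (chi x * mon S x))"
  proof (intro sum.cong refl)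
    fix x assume "x \<in> cube n"
    moreover have "\<forall>i\<in>S. ?flip x ! i = x ! i"
      using j(2) by (auto intro!: nth_list_update_neq)
    then have "mon S (?flip x) = mon S x"
      by (simp add: mon_def)
    ultimately show "chi (?flip x) * mon S (?flip x) = - (chi x * mon S x)"
      using j chi_flip[of j x] by (simp add: cube_def)
  qed
  finally show "(\<Sum>x\<in>cube n. chi x * mon S x) = 0"
    by (simp add: sum_negf)
qed

text \<open>The two-sided error bound becomes two strict inequalities per point, indexed by a sign.
  \<open>gordan\<close> weights them, and the difference of the two weights at a point is, up to
  normalisation, the dual witness.\<close>

lemma approx_dual:
  assumes G: "\<And>x. x \<in> cube n \<Longrightarrow> \<bar>G x\<bar> = 1" and d: "d > 0" and e: "e > 0"
    and no: "\<forall>k<d. \<forall>\<phi>. bool_poly n k \<phi> \<longrightarrow> (\<exists>x\<in>cube n. \<bar>\<phi> x - G x\<bar> \<ge> e)"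
  obtains \<psi> where "pure_high n d \<psi>" "(\<Sum>x\<in>cube n. \<bar>\<psi> x\<bar>) = 1" "(\<Sum>x\<in>cube n. \<psi> x * G x) \<ge> e"
proof -
  \<comment> \<open>Homogenised: \<open>w l \<phi>\<close> is positive on \<open>X\<close> iff \<open>l > 0\<close> and \<open>\<phi> / l\<close> approximates \<open>G\<close> with error below \<open>e\<close>.\<close>
  define X where "X = cube n \<times> {1, - 1 :: real}"
  define w where "w l \<phi> = (\<lambda>(x, s). l * (e + s * G x) - s * \<phi> x)" for l :: real and \<phi> :: "bool list \<Rightarrow> real"
  define W where "W = {w l \<phi> | l \<phi>. bool_poly n (d - 1) \<phi>}"
  have sumX: "(\<Sum>z\<in>X. f z) = (\<Sum>x\<in>cube n. f (x, 1) + f (x, - 1))" for f :: "bool list \<times> real \<Rightarrow> real"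
    unfolding X_def by (simp add: sum.cartesian_product' [where g = f])
  have fin: "finite X" by (simp add: X_def)
  have zero: "(\<lambda>z. 0) \<in> W"
  proof -
    have "(\<lambda>z. 0) = w 0 (\<lambda>x. 0)" by (auto simp: w_def)
    then show ?thesis unfolding W_def using bool_poly_const by blast
  qed
  have add: "(\<lambda>z. u z + v z) \<in> W" if "u \<in> W" "v \<in> W" for u v
  proof -
    obtain l1 p1 l2 p2 where *: "u = w l1 p1" "bool_poly n (d - 1) p1" "v = w l2 p2" "bool_poly n (d - 1) p2"
      using \<open>u \<in> W\<close> \<open>v \<in> W\<close> unfolding W_def by blast
    have "(\<lambda>z. u z + v z) = w (l1 + l2) (\<lambda>x. p1 x + p2 x)"
      by (auto simp: * w_def algebra_simps)
    then show ?thesis unfolding W_def using bool_poly.add[OF *(2,4)] by blast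
  qed
  have scale: "(\<lambda>z. a * u z) \<in> W" if "u \<in> W" for a u
  proof -
    obtain l p where *: "u = w l p" "bool_poly n (d - 1) p"
      using \<open>u \<in> W\<close> unfolding W_def by blast
    have "(\<lambda>z. a * u z) = w (a * l) (\<lambda>x. a * p x)"
      by (auto simp: * w_def algebra_simps)
    then show ?thesis unfolding W_def using bool_poly.scale[OF *(2)] by blast
  qed
  have no_pos: "\<not> (\<exists>u\<in>W. \<forall>z\<in>X. u z > 0)"
  proof
    assume "\<exists>u\<in>W. \<forall>z\<in>X. u z > 0"
    then obtain l p where p: "bool_poly n (d - 1) p" and pos: "\<forall>z\<in>X. w l p z > 0"
      unfolding W_def by blast
    have pos: "l * e > \<bar>p x - l * G x\<bar>" if "x \<in> cube n" for x
      using pos[rule_format, of "(x, 1)"] pos[rule_format, of "(x, - 1)"] that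
      by (auto simp: X_def w_def algebra_simps abs_if)
    \<comment> \<open>Any one point of the cube gives \<open>l * e > 0\<close>, so division by
      \<open>l\<close> is possible.\<close>
    have "replicate n False \<in> cube n" by (simp add: cube_def)
    from pos[OF this] have l: "l > 0"
      using e by (meson abs_ge_zero le_less_trans zero_less_mult_pos2)
    have "bool_poly n (d - 1) (\<lambda>x. (1 / l) * p x)" using p by (rule bool_poly.scale)
    then obtain x where x: "x \<in> cube n" "\<bar>(1 / l) * p x - G x\<bar> \<ge> e"
      using no[rule_format, of "d - 1" "\<lambda>x. (1 / l) * p x"] d by auto
    have "\<bar>p x - l * G x\<bar> = l * \<bar>(1 / l) * p x - G x\<bar>"
      using l by (simp add: abs_mult_pos' right_diff_distrib)
    then show False using pos[OF x(1)] x(2) l by (smt (verit) mult_left_mono)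
  qed
  obtain \<mu> where \<mu>: "\<And>z. z \<in> X \<Longrightarrow> \<mu> z \<ge> 0" "\<exists>z\<in>X. \<mu> z > 0" "\<And>u. u \<in> W \<Longrightarrow> (\<Sum>z\<in>X. \<mu> z * u z) = 0"
    using gordan[OF fin zero add scale no_pos] by blast
  \<comment> \<open>With this orientation, testing \<open>\<mu>\<close> on \<open>w 1\<close> of the
    zero polynomial makes the correlation with \<open>G\<close> equal to \<open>e\<close> times the
    total mass of \<open>\<mu>\<close>.\<close>
  define \<psi> where "\<psi> x = \<mu> (x, - 1) - \<mu> (x, 1)" for x
  define N where "N = (\<Sum>x\<in>cube n. \<bar>\<psi> x\<bar>)"
  have orth: "(\<Sum>x\<in>cube n. \<psi> x * \<phi> x) = 0" if "bool_poly n (d - 1) \<phi>" for \<phi>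
  proof -
    have "w 0 \<phi> \<in> W" unfolding W_def using that by blast
    from \<mu>(3)[OF this] show ?thesis
      by (simp add: sumX w_def \<psi>_def algebra_simps)
  qed
  have "w 1 (\<lambda>x. 0) \<in> W" unfolding W_def using bool_poly_const by blast
  from \<mu>(3)[OF this] have "(\<Sum>x\<in>cube n. \<psi> x * G x) = e * (\<Sum>x\<in>cube n. \<mu> (x, 1) + \<mu> (x, - 1))"
    by (simp add: sumX w_def \<psi>_def algebra_simps sum.distrib sum_subtractf sum_distrib_left)
  moreover have "N \<le> (\<Sum>x\<in>cube n. \<mu> (x, 1) + \<mu> (x, - 1))"
    unfolding N_def
  proof (rule sum_mono)
    fix x assume "x \<in> cube n"
    then have "\<mu> (x, 1) \<ge> 0" "\<mu> (x, - 1) \<ge> 0" using \<mu>(1) by (auto simp: X_def)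
    then show "\<bar>\<psi> x\<bar> \<le> \<mu> (x, 1) + \<mu> (x, - 1)" by (simp add: \<psi>_def)
  qed
  moreover have "(\<Sum>x\<in>cube n. \<mu> (x, 1) + \<mu> (x, - 1)) > 0"
    unfolding sumX[of \<mu>, symmetric] using \<mu>(1,2) fin by (auto intro: sum_pos2)
  ultimately have corr: "(\<Sum>x\<in>cube n. \<psi> x * G x) \<ge> e * N" "(\<Sum>x\<in>cube n. \<psi> x * G x) > 0"
    using e by auto
  \<comment> \<open>The two weights at a point might cancel in \<open>\<psi>\<close>; positive
    correlation excludes that this happens everywhere, so \<open>N\<close> is positive.\<close>
  have "(\<Sum>x\<in>cube n. \<psi> x * G x) \<le> N"
    unfolding N_def
  proof (rule sum_mono)
    fix x assume "x \<in> cube n"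
    then show "\<psi> x * G x \<le> \<bar>\<psi> x\<bar>"
      using G[of x] by (metis abs_ge_self abs_mult mult.right_neutral)
  qed
  then have N: "N > 0" using corr(2) by linarith
  show ?thesis
  proof (rule that[of "\<lambda>x. \<psi> x / N"])
    show "pure_high n d (\<lambda>x. \<psi> x / N)"
    proof (rule pure_highI)
      fix \<phi> k assume "bool_poly n k \<phi>" "k < d"
      then have "bool_poly n (d - 1) \<phi>" by (elim bool_poly_mono) auto
      from orth[OF this] show "(\<Sum>x\<in>cube n. \<psi> x / N * \<phi> x) = 0"
        by (simp flip: sum_divide_distrib)
    qed
    show "(\<Sum>x\<in>cube n. \<bar>\<psi> x / N\<bar>) = 1"
      using N by (simp flip: sum_divide_distrib N_def)
    show "(\<Sum>x\<in>cube n. \<psi> x / N * G x) \<ge> e"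
      using N corr(1) by (simp add: pos_le_divide_eq flip: sum_divide_distrib)
  qed
qed

text \<open>No polynomial of degree \<open>t - 1\<close> has the signs of \<open>F\<close>, so
  \<open>gordan\<close> yields \<open>\<mu>\<close> for which \<open>\<mu> x * sgnb (F x)\<close>
  annihilates that degree. Such a function is a multiple of \<open>chi\<close>.\<close>

lemma full_sign_degree_imp_parity:
  assumes "sign_degree t F = t"
  obtains s where "\<bar>s\<bar> = 1" "\<And>x. x \<in> cube t \<Longrightarrow> sgnb (F x) = s * chi x"
proof (cases "t = 0")
  \<comment> \<open>Here \<open>t - 1\<close> is again \<open>0\<close>, so no smaller degree is
    excluded; but the cube is a single point.\<close>
  case True
  show ?thesis
    by (rule that[of "sgnb (F [])"]) (use True in \<open>auto simp: cube_def chi_def\<close>)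
next
  case False
  define W where "W = {\<lambda>x. sgnb (F x) * \<phi> x | \<phi>. bool_poly t (t - 1) \<phi>}"
  have WI: "(\<lambda>x. sgnb (F x) * \<phi> x) \<in> W" if "bool_poly t (t - 1) \<phi>" for \<phi>
    unfolding W_def using that by (intro CollectI exI[of _ \<phi>] conjI refl)
  have zero: "(\<lambda>x. 0) \<in> W"
    using WI[OF bool_poly_const[of t "t - 1" 0]] by simp
  have add: "(\<lambda>x. u x + v x) \<in> W" if "u \<in> W" "v \<in> W" for u v
  proof -
    obtain p q where *: "u = (\<lambda>x. sgnb (F x) * p x)" "bool_poly t (t - 1) p"
      "v = (\<lambda>x. sgnb (F x) * q x)" "bool_poly t (t - 1) q"
      using \<open>u \<in> W\<close> \<open>v \<in> W\<close> unfolding W_def by blast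
    show ?thesis using WI[OF bool_poly.add[OF *(2,4)]] by (simp add: *(1,3) distrib_left)
  qed
  have scale: "(\<lambda>x. a * u x) \<in> W" if "u \<in> W" for a u
  proof -
    obtain p where *: "u = (\<lambda>x. sgnb (F x) * p x)" "bool_poly t (t - 1) p"
      using \<open>u \<in> W\<close> unfolding W_def by blast
    show ?thesis using WI[OF bool_poly.scale[OF *(2), of a]] by (simp add: *(1) mult.left_commute)
  qed
  have no_pos: "\<not> (\<exists>u\<in>W. \<forall>x\<in>cube t. u x > 0)"
  proof
    assume "\<exists>u\<in>W. \<forall>x\<in>cube t. u x > 0"
    then obtain p where p: "bool_poly t (t - 1) p" "\<forall>x\<in>cube t. sgnb (F x) * p x > 0"
      unfolding W_def by blast
    have "sign_degree t F \<le> t - 1"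
      using p by (intro sign_degree_le[of t "t - 1" p]) simp_all
    then show False using assms False by simp
  qed
  obtain \<mu> where \<mu>: "\<And>x. x \<in> cube t \<Longrightarrow> \<mu> x \<ge> 0" "\<exists>x\<in>cube t. \<mu> x > 0"
    "\<And>u. u \<in> W \<Longrightarrow> (\<Sum>x\<in>cube t. \<mu> x * u x) = 0"
    using gordan[OF finite_cube zero add scale no_pos] by blast
  define \<nu> where "\<nu> x = \<mu> x * sgnb (F x)" for x
  have orth: "(\<Sum>x\<in>cube t. \<nu> x * \<phi> x) = 0" if "bool_poly t (t - 1) \<phi>" for \<phi>
    using \<mu>(3)[OF WI[OF that]] by (simp add: \<nu>_def mult.assoc)
  \<comment> \<open>The indicator of an edge of the cube has degree \<open>t - 1\<close>, so \<open>\<nu>\<close> alternates along edges.\<close>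
  have edge: "\<nu> (a[j := \<not> a ! j]) = - \<nu> a" if a: "a \<in> cube t" and j: "j < t" for a j
  proof -
    let ?b = "a[j := \<not> a ! j]"
    have "bool_poly t (t - 1) (\<lambda>x. of_bool (\<forall>i\<in>{..<t} - {j}. x ! i = a ! i))"
      using bool_poly_all_eq[of "{..<t} - {j}" t a] j by simp
    from orth[OF this]
    have "(\<Sum>x\<in>cube t. \<nu> x * of_bool (\<forall>i\<in>{..<t} - {j}. x ! i = a ! i)) = 0" .
    moreover have "(\<forall>i\<in>{..<t} - {j}. x ! i = a ! i) \<longleftrightarrow> x \<in> {a, ?b}" if x: "x \<in> cube t" for x
    proof
      assume *: "\<forall>i\<in>{..<t} - {j}. x ! i = a ! i"
      have "x = a[j := x ! j]"
        using * a x j by (intro nth_equalityI) (auto simp: cube_def nth_list_update)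
      then obtain b where "x = a[j := b]" by blast
      then show "x \<in> {a, ?b}"
        by (cases "b = a ! j") auto
    qed (use j in auto)
    then have "(\<Sum>x\<in>cube t. \<nu> x * of_bool (\<forall>i\<in>{..<t} - {j}. x ! i = a ! i))
        = (\<Sum>x\<in>cube t. if x \<in> {a, ?b} then \<nu> x else 0)"
      by (intro sum.cong) auto
    also have "\<dots> = (\<Sum>x\<in>{a, ?b}. \<nu> x)"
    proof -
      have "{a, ?b} \<subseteq> cube t" using a by (simp add: cube_def)
      then show ?thesis
        using sum.inter_restrict[OF finite_cube[of t], where g = \<nu> and B = "{a, ?b}"]
        by (simp only: Int_absorb1)
    qed
    also have "\<dots> = \<nu> a + \<nu> ?b"
    proof -
      have "a \<noteq> ?b"
      proof
        assume "a = ?b"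
        then have "a ! j = ?b ! j" by (rule arg_cong)
        then show False using j a by (simp add: cube_def)
      qed
      then show ?thesis by simp
    qed
    ultimately show ?thesis by simp
  qed
  \<comment> \<open>Both factors change sign along every edge, so the product is constant on the
    connected cube.\<close>
  define \<kappa> where "\<kappa> x = \<nu> x * chi x" for x
  define \<kappa>0 where "\<kappa>0 = \<kappa> (replicate t False)"
  have step: "\<kappa> (x[j := b]) = \<kappa> x" if "x \<in> cube t" "j < t" for x j b
  proof (cases "b = x ! j")
    case False
    then have "x[j := b] = x[j := \<not> x ! j]" by simp
    then show ?thesis
      using edge[OF that] chi_flip[of j x] that by (simp add: \<kappa>_def cube_def)
  qed simp
  have const: "\<kappa> x = \<kappa>0" if x: "x \<in> cube t" for x
  proof -
    \<comment> \<open>A path to the all-\<open>False\<close> point, clearing coordinates from the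
      left.\<close>
    have "\<kappa> x = \<kappa> (replicate i False @ drop i x)" if "i \<le> t" for i
      using that
    proof (induction i)
      case (Suc i)
      have "drop i x = x ! i # drop (Suc i) x"
        using Suc.prems x by (simp add: cube_def Cons_nth_drop_Suc)
      then have "(replicate i False @ drop i x)[i := False] = replicate (Suc i) False @ drop (Suc i) x"
        by (simp add: list_update_append replicate_app_Cons_same)
      moreover have "\<kappa> ((replicate i False @ drop i x)[i := False]) = \<kappa> (replicate i False @ drop i x)"
        using Suc.prems x by (intro step) (auto simp: cube_def)
      ultimately show ?case using Suc by simp
    qed simp
    from this[of t] x show ?thesis by (simp add: \<kappa>0_def cube_def)
  qed
  \<comment> \<open>So \<open>\<mu>\<close> is constant; being positive somewhere, it is positive
    everywhere, and the sign of \<open>F\<close> can be read off at every point.\<close>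
  have abs: "\<bar>\<kappa>0\<bar> = \<mu> x" if "x \<in> cube t" for x
    using const[OF that] \<mu>(1)[OF that] by (auto simp: \<kappa>_def \<nu>_def abs_mult)
  then have "\<kappa>0 \<noteq> 0" using \<mu>(2) by force
  show ?thesis
  proof (rule that[of "sgn \<kappa>0"])
    show "\<bar>sgn \<kappa>0\<bar> = 1" using \<open>\<kappa>0 \<noteq> 0\<close> by (simp add: abs_sgn_eq)
    fix x assume x: "x \<in> cube t"
    have "\<kappa>0 = \<bar>\<kappa>0\<bar> * (sgnb (F x) * chi x)"
      using const[OF x] abs[OF x] by (simp add: \<kappa>_def \<nu>_def mult_ac)
    moreover have "\<kappa>0 = \<bar>\<kappa>0\<bar> * sgn \<kappa>0" by (simp add: abs_mult_sgn)
    ultimately have "sgn \<kappa>0 = sgnb (F x) * chi x"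
      using \<open>\<kappa>0 \<noteq> 0\<close> by (metis (no_types) abs_eq_0 mult_cancel_left)
    then show "sgnb (F x) = sgn \<kappa>0 * chi x"
      using chi_cases[of x] by auto
  qed
qed

subsection \<open>Block decomposition of the cube\<close>

definition blk :: "nat \<Rightarrow> nat \<Rightarrow> bool list \<Rightarrow> bool list" where
  "blk m i x = take m (drop (i * m) x)"

text \<open>The trace of \<open>S\<close> on block \<open>i\<close>, in coordinates local to the
  block.\<close>

definition blkset :: "nat \<Rightarrow> nat \<Rightarrow> nat set \<Rightarrow> nat set" where
  "blkset m i S = {j. j < m \<and> i * m + j \<in> S}"

lemma bcomp_blk: "bcomp n m F G x = F (map (\<lambda>i. G (blk m i x)) [0..<n])"
  by (simp add: bcomp_def blk_def)

lemma block_index_less: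
  fixes i j m n :: nat
  assumes "i < n" "j < m"
  shows "i * m + j < n * m"
proof -
  have "i * m + j < Suc i * m" using assms(2) by simp
  also have "\<dots> \<le> n * m" using assms(1) by (intro mult_le_mono1) simp
  finally show ?thesis .
qed

lemma blk_in_cube:
  assumes "x \<in> cube (n * m)" "i < n"
  shows "blk m i x \<in> cube m"
proof -
  have "Suc i * m \<le> n * m" using assms(2) by (intro mult_le_mono1) simp
  then show ?thesis using assms(1) by (simp add: blk_def cube_def)
qed

lemma blk_nth:
  assumes "x \<in> cube (n * m)" "i < n" "j < m"
  shows "blk m i x ! j = x ! (i * m + j)"
  using assms block_index_less[OF assms(2,3)] by (simp add: blk_def cube_def)

lemma blk_append:
  assumes "length u = m"
  shows "blk m 0 (u @ v) = u" "blk m (Suc i) (u @ v) = blk m i v"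
  using assms by (simp_all add: blk_def)

section \<open>Factorisation of sums and monomials over blocks\<close>

lemma sum_cube_append:
  fixes f :: "bool list \<Rightarrow> real"
  shows "(\<Sum>x\<in>cube (m + k). f x) = (\<Sum>u\<in>cube m. \<Sum>v\<in>cube k. f (u @ v))"
proof -
  have "bij_betw (\<lambda>(u, v). u @ v) (cube m \<times> cube k) (cube (m + k))"
    by (intro bij_betw_byWitness[where f' = "\<lambda>x. (take m x, drop m x)"]) (auto simp: cube_def)
  from sum.reindex_bij_betw[OF this, of f, symmetric] show ?thesis
    by (simp add: sum.cartesian_product case_prod_unfold)
qed

lemma sum_cube_blocks:
  fixes f :: "nat \<Rightarrow> bool list \<Rightarrow> real"
  shows "(\<Sum>x\<in>cube (n * m). \<Prod>i<n. f i (blk m i x)) = (\<Prod>i<n. \<Sum>u\<in>cube m. f i u)"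
proof (induction n arbitrary: f)
  case 0
  then show ?case by (simp add: cube_def)
next
  case (Suc n)
  have "(\<Sum>x\<in>cube (Suc n * m). \<Prod>i<Suc n. f i (blk m i x))
      = (\<Sum>u\<in>cube m. \<Sum>v\<in>cube (n * m). \<Prod>i<Suc n. f i (blk m i (u @ v)))"
    by (simp add: sum_cube_append)
  also have "\<dots> = (\<Sum>u\<in>cube m. \<Sum>v\<in>cube (n * m). f 0 u * (\<Prod>i<n. f (Suc i) (blk m i v)))"
    by (intro sum.cong refl) (simp add: prod.lessThan_Suc_shift blk_append cube_def del: prod.lessThan_Suc)
  also have "\<dots> = (\<Sum>u\<in>cube m. f 0 u) * (\<Prod>i<n. \<Sum>u\<in>cube m. f (Suc i) u)"
    by (simp add: Suc.IH[of "\<lambda>i. f (Suc i)"] sum_distrib_left[symmetric] sum_distrib_right)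
  finally show ?case
    by (simp add: prod.lessThan_Suc_shift del: prod.lessThan_Suc)
qed

lemma mon_blocks:
  assumes "S \<subseteq> {..<n * m}" "x \<in> cube (n * m)"
  shows "mon S x = (\<Prod>i<n. mon (blkset m i S) (blk m i x))"
proof -
  have "(\<forall>k\<in>S. x ! k) \<longleftrightarrow> (\<forall>i\<in>{..<n}. \<forall>j\<in>blkset m i S. blk m i x ! j)"
  proof (intro iffI ballI)
    fix i j assume "\<forall>k\<in>S. x ! k" "i \<in> {..<n}" "j \<in> blkset m i S"
    then show "blk m i x ! j"
      using blk_nth[OF assms(2), of i j] by (simp add: blkset_def)
  next
    fix k assume *: "\<forall>i\<in>{..<n}. \<forall>j\<in>blkset m i S. blk m i x ! j" and k: "k \<in> S"
    then have "k < n * m" using assms(1) by blast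
    then have "m > 0" by (cases m) auto
    then have j: "k mod m < m" by simp
    have i: "k div m < n" using \<open>k < n * m\<close> by (simp add: less_mult_imp_div_less)
    have "k mod m \<in> blkset m (k div m) S" using k j by (simp add: blkset_def)
    then have "blk m (k div m) x ! (k mod m)" using * i by blast
    then show "x ! k" using blk_nth[OF assms(2) i j] by simp
  qed
  then show ?thesis
    unfolding mon_def by (simp only: of_bool_Ball[OF finite_lessThan, symmetric])
qed

text \<open>The traces on distinct blocks embed disjointly into \<open>S\<close>, by uniqueness of
  division with remainder.\<close>

lemma sum_card_blkset_le:
  assumes "finite S"
  shows "(\<Sum>i<n. card (blkset m i S)) \<le> card S"
proof -
  have fin: "finite (blkset m i S)" for i by (simp add: blkset_def)
  let ?f = "\<lambda>(i, j). i * m + j"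
  have inj: "inj_on ?f (SIGMA i:{..<n}. blkset m i S)"
  proof (rule inj_onI, clarsimp simp: blkset_def)
    fix i j i' j' assume less: "j < m" "j' < m" and eq: "i * m + j = i' * m + j'"
    from less have "(i * m + j) div m = i" "(i' * m + j') div m = i'" by simp_all
    then have "i = i'" using eq by metis
    with eq show "i = i' \<and> j = j'" by simp
  qed
  have "(\<Sum>i<n. card (blkset m i S)) = card (SIGMA i:{..<n}. blkset m i S)"
    using fin by simp
  also have "\<dots> = card (?f ` (SIGMA i:{..<n}. blkset m i S))"
    using inj by (rule card_image[symmetric])
  also have "\<dots> \<le> card S"
    using assms by (intro card_mono) (auto simp: blkset_def)
  finally show ?thesis .
qed

text \<open>By pigeonhole, a set of fewer than \<open>card T * d\<close> indices meets some block of
  \<open>T\<close> in fewer than \<open>d\<close>. The sum factorises over blocks and the factor of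
  that block vanishes; blocks outside \<open>T\<close> may carry any function.\<close>

lemma pure_high_blocks:
  assumes T: "T \<subseteq> {..<n}" "\<And>i. i \<in> T \<Longrightarrow> pure_high m d (\<eta> i)"
  shows "pure_high (n * m) (card T * d) (\<lambda>x. \<Prod>i<n. \<eta> i (blk m i x))"
  unfolding pure_high_def
proof (intro allI impI)
  fix S assume S: "S \<subseteq> {..<n * m}" "card S < card T * d"
  have fin: "finite S" using S(1) by (rule finite_subset) simp
  have "\<exists>i\<in>T. card (blkset m i S) < d"
  proof (rule ccontr)
    assume "\<not> (\<exists>i\<in>T. card (blkset m i S) < d)"
    then have "card T * d \<le> (\<Sum>i\<in>T. card (blkset m i S))"
      using sum_bounded_below[of T d "\<lambda>i. card (blkset m i S)"] by (simp add: not_less)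
    also have "\<dots> \<le> (\<Sum>i<n. card (blkset m i S))"
      using T(1) by (intro sum_mono2) auto
    also have "\<dots> \<le> card S" using fin by (rule sum_card_blkset_le)
    finally show False using S(2) by simp
  qed
  then obtain i where i: "i \<in> T" "card (blkset m i S) < d" by blast
  have "blkset m i S \<subseteq> {..<m}" by (auto simp: blkset_def)
  then have zero: "(\<Sum>u\<in>cube m. \<eta> i u * mon (blkset m i S) u) = 0"
    using T(2)[OF i(1)] i(2) by (simp add: pure_high_def)
  have "(\<Sum>x\<in>cube (n * m). (\<Prod>i<n. \<eta> i (blk m i x)) * mon S x)
      = (\<Sum>x\<in>cube (n * m). \<Prod>i<n. \<eta> i (blk m i x) * mon (blkset m i S) (blk m i x))"
    using S(1) by (intro sum.cong refl) (simp add: mon_blocks prod.distrib)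
  also have "\<dots> = (\<Prod>i<n. \<Sum>u\<in>cube m. \<eta> i u * mon (blkset m i S) u)"
    by (rule sum_cube_blocks[where f = "\<lambda>i u. \<eta> i u * mon (blkset m i S) u"])
  also have "\<dots> = 0"
    using zero i(1) T(1) by (intro prod_zero) auto
  finally show "(\<Sum>x\<in>cube (n * m). (\<Prod>i<n. \<eta> i (blk m i x)) * mon S x) = 0" .
qed

lemma chi_map: "chi (map p [0..<n]) = (\<Prod>i<n. sgnb (p i))"
  by (induction n) (simp_all add: chi_def)

lemma chi_blocks: "x \<in> cube (n * m) \<Longrightarrow> chi x = (\<Prod>i<n. chi (blk m i x))"
proof (induction n arbitrary: x)
  case 0
  then show ?case by (simp add: cube_def chi_def)
next
  case (Suc n)
  have x: "x = take m x @ drop m x" by simp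
  have len: "length (take m x) = m" "drop m x \<in> cube (n * m)"
    using Suc.prems by (auto simp: cube_def)
  have "chi x = chi (take m x) * chi (drop m x)"
    by (subst x) (simp only: chi_append)
  also have "\<dots> = chi (blk m 0 (take m x @ drop m x)) * (\<Prod>i<n. chi (blk m (Suc i) (take m x @ drop m x)))"
    by (simp only: blk_append[OF len(1)] Suc.IH[OF len(2)])
  also have "\<dots> = (\<Prod>i<Suc n. chi (blk m i x))"
    by (simp add: prod.lessThan_Suc_shift del: prod.lessThan_Suc)
  finally show ?case .
qed

text \<open>The parity of block parities is the parity of the whole input; a global sign
  \<open>s'\<close> of the inner function is collected once per block.\<close>

lemma bpow_parity:
  assumes s: "\<bar>s\<bar> = 1" "\<And>x. x \<in> cube t \<Longrightarrow> sgnb (F x) = s * chi x"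
  shows "\<exists>s'. \<bar>s'\<bar> = 1 \<and> (\<forall>x\<in>cube (t ^ d). sgnb (bpow t F d x) = s' * chi x)"
proof (induction d)
  case 0
  have "sgnb (hd x) = chi x" if "x \<in> cube 1" for x
    using that by (auto simp: cube_def chi_def length_Suc_conv)
  then show ?case by (intro exI[of _ 1]) simp
next
  case (Suc d)
  then obtain s' where s': "\<bar>s'\<bar> = 1" "\<And>x. x \<in> cube (t ^ d) \<Longrightarrow> sgnb (bpow t F d x) = s' * chi x"
    by blast
  have "sgnb (bpow t F (Suc d) x) = (s * s' ^ t) * chi x" if x: "x \<in> cube (t ^ Suc d)" for x
  proof -
    have x': "x \<in> cube (t * t ^ d)" using x by simp
    have "sgnb (bpow t F (Suc d) x) = s * (\<Prod>i<t. sgnb (bpow t F d (blk (t ^ d) i x)))"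
      by (simp add: bcomp_blk s(2) cube_def chi_map)
    also have "(\<Prod>i<t. sgnb (bpow t F d (blk (t ^ d) i x))) = (\<Prod>i<t. s' * chi (blk (t ^ d) i x))"
      using s'(2) blk_in_cube[OF x'] by (intro prod.cong) auto
    also have "\<dots> = s' ^ t * chi x"
      by (simp add: prod.distrib chi_blocks[OF x'])
    finally show ?thesis by simp
  qed
  moreover have "\<bar>s * s' ^ t\<bar> = 1" using s(1) s'(1) by (simp add: abs_mult power_abs)
  ultimately show ?case by blast
qed

subsection \<open>Parity as the inner function\<close>

lemma approx_degree_parity_inner:
  assumes s: "\<bar>s\<bar> = 1" "\<And>x. x \<in> cube m \<Longrightarrow> sgnb (g x) = s * chi x" and m: "m > 0"
  shows "m * approx_degree n f \<le> approx_degree (n * m) (bcomp n m f g)"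
proof -
  define k where "k = approx_degree (n * m) (bcomp n m f g)"
  obtain \<phi> where \<phi>: "bool_poly (n * m) k \<phi>"
    "\<And>x. x \<in> cube (n * m) \<Longrightarrow> \<bar>\<phi> x - of_bool (bcomp n m f g x)\<bar> \<le> 1 / 3"
    using approx_degree_attained[of "n * m" "bcomp n m f g"] unfolding k_def by blast
  \<comment> \<open>On the cube each factor is \<open>2\<close> if \<open>g\<close> maps block
    \<open>i\<close> to \<open>y ! i\<close>, and \<open>0\<close> otherwise. Thus
    \<open>w y\<close> is supported on the fibre of \<open>y\<close>, and \<open>q y\<close>
    averages \<open>\<phi>\<close> over it.\<close>
  define w where "w y x = (\<Prod>i<n. s * sgnb (y ! i) * chi (blk m i x) + 1)" for y x
  define N :: real where "N = (2 ^ m) ^ n"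
  define q where "q y = (\<Sum>x\<in>cube (n * m). w y x * \<phi> x) / N" for y
  have N: "N > 0" by (simp add: N_def)
  define a where "a T = s ^ card T / N * (\<Sum>x\<in>cube (n * m). (\<Prod>i\<in>T. chi (blk m i x)) * \<phi> x)" for T
  \<comment> \<open>Expanding the product in \<open>w\<close> gives the Fourier expansion of
    \<open>q\<close>: \<open>a T\<close> is, up to normalisation, the correlation of
    \<open>\<phi>\<close> with the parity of the blocks in \<open>T\<close>.\<close>
  have q: "q y = (\<Sum>T\<in>Pow {..<n}. a T * (\<Prod>i\<in>T. sgnb (y ! i)))" for y
  proof -
    have "w y x = (\<Sum>T\<in>Pow {..<n}. s ^ card T * (\<Prod>i\<in>T. sgnb (y ! i)) * (\<Prod>i\<in>T. chi (blk m i x)))" for x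
      unfolding w_def by (subst prod_add) (simp_all add: prod.distrib)
    then have "q y = (\<Sum>x\<in>cube (n * m). \<Sum>T\<in>Pow {..<n}.
        s ^ card T * (\<Prod>i\<in>T. sgnb (y ! i)) * (\<Prod>i\<in>T. chi (blk m i x)) * \<phi> x / N)"
      by (simp add: q_def sum_distrib_right sum_divide_distrib)
    also have "\<dots> = (\<Sum>T\<in>Pow {..<n}. \<Sum>x\<in>cube (n * m).
        s ^ card T * (\<Prod>i\<in>T. sgnb (y ! i)) * (\<Prod>i\<in>T. chi (blk m i x)) * \<phi> x / N)"
      by (rule sum.swap)
    also have "\<dots> = (\<Sum>T\<in>Pow {..<n}. a T * (\<Prod>i\<in>T. sgnb (y ! i)))"
      unfolding a_def sum_distrib_left sum_distrib_right by (intro sum.cong refl) simp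
    finally show ?thesis .
  qed
  have "bool_poly n (k div m) (\<lambda>y. \<Sum>T\<in>Pow {..<n}. a T * (\<Prod>i\<in>T. sgnb (y ! i)))"
  proof (rule bool_poly_sum)
    fix T assume T: "T \<in> Pow {..<n}"
    then have fin: "finite T" by (auto intro: finite_subset)
    show "bool_poly n (k div m) (\<lambda>y. a T * (\<Prod>i\<in>T. sgnb (y ! i)))"
    proof (cases "card T * m \<le> k")
      case True
      then have "card T \<le> k div m" using m by (simp add: less_eq_div_iff_mult_less_eq)
      moreover have "bool_poly n (card T) (\<lambda>y. \<Prod>i\<in>T. sgnb (y ! i))"
        using T by (intro bool_poly_prod fin bool_poly_sgnb) auto
      ultimately show ?thesis by (intro bool_poly.scale) (rule bool_poly_mono)
    next
      case False
      \<comment> \<open>The parity of the blocks in \<open>T\<close> has pure high degree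
        \<open>card T * m\<close>, which exceeds \<open>k\<close>, so the coefficient
        \<open>a T\<close> vanishes.\<close>
      let ?\<eta> = "\<lambda>i. if i \<in> T then chi else (\<lambda>_. 1)"
      have "pure_high (n * m) (card T * m) (\<lambda>x. \<Prod>i<n. ?\<eta> i (blk m i x))"
        using T by (intro pure_high_blocks) (auto simp: pure_high_chi)
      then have "(\<Sum>x\<in>cube (n * m). (\<Prod>i<n. ?\<eta> i (blk m i x)) * \<phi> x) = 0"
        using \<phi>(1) by (rule pure_highD) (use False in simp)
      moreover have "(\<Prod>i<n. ?\<eta> i (blk m i x)) = (\<Prod>i\<in>T. chi (blk m i x))" for x
      proof -
        have "(\<Prod>i<n. ?\<eta> i (blk m i x)) = (\<Prod>i<n. if i \<in> T then chi (blk m i x) else 1)"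
          by (intro prod.cong) auto
        also have "\<dots> = (\<Prod>i\<in>{..<n} \<inter> T. chi (blk m i x))"
          by (simp add: prod.inter_restrict)
        finally show ?thesis using T by (simp add: Int_absorb1)
      qed
      ultimately have "a T = 0" by (simp add: a_def)
      then show ?thesis by (simp add: bool_poly_const)
    qed
  qed simp
  then have "bool_poly n (k div m) q" by (rule bool_poly.cong) (rule q)
  \<comment> \<open>The weights \<open>w y x / N\<close> are nonnegative, sum to \<open>1\<close>,
    and live where the composition equals \<open>f y\<close>; averaging preserves the error.\<close>
  moreover have "\<bar>q y - of_bool (f y)\<bar> \<le> 1 / 3" if y: "y \<in> cube n" for y
  proof -
    have pm: "s * sgnb (y ! i) * chi u = 1 \<or> s * sgnb (y ! i) * chi u = - 1" for i u
    proof -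
      have "\<bar>s * sgnb (y ! i) * chi u\<bar> = 1" using s(1) by (simp add: abs_mult)
      then show ?thesis by linarith
    qed
    have w0: "w y x \<ge> 0" for x
      unfolding w_def
    proof (rule prod_nonneg)
      fix i
      show "s * sgnb (y ! i) * chi (blk m i x) + 1 \<ge> 0" using pm[of i "blk m i x"] by auto
    qed
    have fibre: "bcomp n m f g x = f y" if x: "x \<in> cube (n * m)" and nz: "w y x \<noteq> 0" for x
    proof -
      have "g (blk m i x) = y ! i" if i: "i < n" for i
      proof -
        have "s * sgnb (y ! i) * chi (blk m i x) + 1 \<noteq> 0"
          using nz i unfolding w_def by (auto simp: prod_zero_iff)
        then have "s * chi (blk m i x) * sgnb (y ! i) = 1" using pm[of i "blk m i x"] by (auto simp: mult_ac)
        then have "sgnb (g (blk m i x)) * sgnb (y ! i) = 1"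
          using s(2)[OF blk_in_cube[OF x i]] by simp
        then show ?thesis by (cases "g (blk m i x)"; cases "y ! i") auto
      qed
      then have "map (\<lambda>i. g (blk m i x)) [0..<n] = y"
        using y by (intro nth_equalityI) (auto simp: cube_def)
      then show ?thesis by (simp add: bcomp_blk)
    qed
    have total: "(\<Sum>x\<in>cube (n * m). w y x) = N"
    proof -
      have "(\<Sum>u\<in>cube m. chi u) = 0"
        using pure_highD[OF pure_high_chi bool_poly_const[of m 0 1]] m by simp
      then have "(\<Sum>u\<in>cube m. s * sgnb (y ! i) * chi u + 1) = 2 ^ m" for i
        using card_lists_length_eq[of "UNIV :: bool set" m]
        by (simp add: sum.distrib flip: sum_distrib_left) (simp add: cube_def)
      then show ?thesis
        unfolding w_def
        by (subst sum_cube_blocks[where f = "\<lambda>i u. s * sgnb (y ! i) * chi u + 1"]) (simp add: N_def)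
    qed
    have "N * q y - N * of_bool (f y) = (\<Sum>x\<in>cube (n * m). w y x * (\<phi> x - of_bool (f y)))"
      using N by (simp add: q_def right_diff_distrib sum_subtractf flip: sum_distrib_right total)
    also have "\<bar>\<dots>\<bar> \<le> (\<Sum>x\<in>cube (n * m). w y x * (1 / 3))"
    proof (rule order_trans[OF sum_abs], rule sum_mono)
      fix x assume x: "x \<in> cube (n * m)"
      show "\<bar>w y x * (\<phi> x - of_bool (f y))\<bar> \<le> w y x * (1 / 3)"
      proof (cases "w y x = 0")
        case False
        have "\<bar>\<phi> x - of_bool (f y)\<bar> \<le> 1 / 3" using \<phi>(2)[OF x] fibre[OF x False] by simp
        then show ?thesis unfolding abs_mult abs_of_nonneg[OF w0] by (rule mult_left_mono[OF _ w0])
      qed simp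
    qed
    also have "\<dots> = N / 3" using total by (simp flip: sum_divide_distrib)
    finally have "N * \<bar>q y - of_bool (f y)\<bar> \<le> N * (1 / 3)"
      using N by (simp add: abs_mult flip: right_diff_distrib)
    then show ?thesis using N by (simp only: mult_le_cancel_left_pos)
  qed
  ultimately have "approx_degree n f \<le> k div m" by (rule approx_degree_le)
  then have "m * approx_degree n f \<le> m * (k div m)" by (rule mult_le_mono2)
  also have "\<dots> \<le> k" by simp
  finally show ?thesis by (simp add: k_def)
qed

subsection \<open>Amplification\<close>

text \<open>The odd cubic amplifier: it fixes \<open>-1\<close>, \<open>0\<close> and
  \<open>1\<close> and pushes positive values up to \<open>1\<close> towards
  \<open>1\<close>.\<close>

definition amp :: "real \<Rightarrow> real" where
  "amp t = (3 / 2) * t - (1 / 2) * (t * t * t)"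

lemma bool_poly_amp:
  assumes "bool_poly n k \<phi>"
  shows "bool_poly n (3 * k) (\<lambda>x. amp (\<phi> x))"
proof -
  have "bool_poly n (k + k + k) (\<lambda>x. \<phi> x * \<phi> x * \<phi> x)"
    using assms by (intro bool_poly_mult)
  then have "bool_poly n (3 * k) (\<lambda>x. \<phi> x * \<phi> x * \<phi> x)"
    by (rule bool_poly_mono) simp
  moreover have "bool_poly n (3 * k) \<phi>"
    using assms by (rule bool_poly_mono) simp
  ultimately show ?thesis
    unfolding amp_def by (intro bool_poly_diff bool_poly.scale)
qed

lemma bool_poly_amp_iter: "bool_poly n k \<phi> \<Longrightarrow> bool_poly n (3 ^ j * k) (\<lambda>x. (amp ^^ j) (\<phi> x))"
proof (induction j)
  case (Suc j)
  then show ?case using bool_poly_amp[of n "3 ^ j * k"] by (simp add: mult.assoc)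
qed simp

lemma amp_iter_minus: "(amp ^^ j) (- t) = - (amp ^^ j) t"
  by (induction j) (simp_all add: amp_def)

text \<open>The factorisation \<open>1 - amp r = (1 - r) * (1 - r / 2 - r * r / 2)\<close> shrinks
  the distance to \<open>1\<close> by at least the factor \<open>1 - a / 2\<close> per step, while
  \<open>r\<close> stays above \<open>a\<close>.\<close>

lemma amp_iter_bounds:
  assumes "0 < a" "a \<le> t" "t \<le> 1"
  shows "a \<le> (amp ^^ j) t \<and> (amp ^^ j) t \<le> 1 \<and> 1 - (amp ^^ j) t \<le> (1 - a / 2) ^ j"
proof (induction j)
  case 0
  then show ?case using assms by simp
next
  case (Suc j)
  define r where "r = (amp ^^ j) t"
  have r: "a \<le> r" "r \<le> 1" "1 - r \<le> (1 - a / 2) ^ j"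
    using Suc by (simp_all add: r_def)
  have eq: "1 - amp r = (1 - r) * (1 - r / 2 - r * r / 2)"
    by (simp add: amp_def field_simps)
  have sq: "0 \<le> r * r" "r * r \<le> 1"
    using r assms(1) by (auto intro: mult_le_one)
  have f: "0 \<le> 1 - r / 2 - r * r / 2" "1 - r / 2 - r * r / 2 \<le> 1 - a / 2"
    using r sq assms(1) by linarith+
  have "1 - amp r \<ge> 0"
    unfolding eq using r(2) f(1) by (intro mult_nonneg_nonneg) auto
  moreover have "1 - amp r \<le> (1 - r) * 1"
    unfolding eq using r(2) f(2) assms(1) by (intro mult_left_mono) auto
  moreover have "1 - amp r \<le> (1 - a / 2) ^ j * (1 - a / 2)"
    unfolding eq using r f by (intro mult_mono) auto
  ultimately show ?case using r(1) by (simp add: r_def mult.commute)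
qed

text \<open>The number \<open>j\<close> of amplifier iterations depends on \<open>\<delta>\<close>
  alone, and each multiplies the degree by \<open>3\<close>.\<close>

lemma approx_degree_amplify:
  assumes "\<delta> > 0" "\<delta> \<le> 1"
  shows "\<exists>K>0. \<forall>n k \<phi> F. bool_poly n k \<phi> \<longrightarrow>
    (\<forall>x\<in>cube n. \<bar>\<phi> x - sgnb (F x)\<bar> \<le> 1 - \<delta>) \<longrightarrow> approx_degree n F \<le> K * k"
proof -
  \<comment> \<open>The rate comes from \<open>amp_iter_bounds\<close> with
    \<open>a = \<delta> / 2\<close>; error \<open>2 / 3\<close> on signs is error
    \<open>1 / 3\<close> on bits.\<close>
  obtain j where j: "(1 - \<delta> / 4) ^ j < 2 / 3"
    using real_arch_pow_inv[of "2 / 3" "1 - \<delta> / 4"] assms by auto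
  show ?thesis
  proof (rule exI[of _ "3 ^ j"], intro conjI allI impI)
    fix n k \<phi> F
    assume \<phi>: "bool_poly n k \<phi>" "\<forall>x\<in>cube n. \<bar>\<phi> x - sgnb (F x)\<bar> \<le> 1 - \<delta>"
    \<comment> \<open>Up to the sign of \<open>F\<close>, \<open>\<phi>\<close> lies between
      \<open>\<delta>\<close> and \<open>2 - \<delta>\<close>; halving brings it into the range of
      \<open>amp_iter_bounds\<close>.\<close>
    define \<psi> where "\<psi> x = (amp ^^ j) ((1 / 2) * \<phi> x)" for x
    have "bool_poly n (3 ^ j * k) \<psi>"
      unfolding \<psi>_def by (intro bool_poly_amp_iter bool_poly.scale \<phi>(1))
    then have "bool_poly n (3 ^ j * k) (\<lambda>x. (1 / 2) * (1 - \<psi> x))"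
      by (intro bool_poly.scale bool_poly_diff bool_poly_const)
    then show "approx_degree n F \<le> 3 ^ j * k"
    proof (rule approx_degree_le)
      fix x assume x: "x \<in> cube n"
      define u where "u = sgnb (F x) * ((1 / 2) * \<phi> x)"
      have "\<delta> / 2 \<le> u" "u \<le> 1"
        using bspec[OF \<phi>(2) x] assms(1) by (cases "F x"; simp add: u_def abs_le_iff; linarith)+
      then have "1 - (amp ^^ j) u \<le> 2 / 3" "(amp ^^ j) u \<le> 1"
        using amp_iter_bounds[of "\<delta> / 2" u j] assms(1) j by simp_all
      moreover have "(amp ^^ j) u = sgnb (F x) * \<psi> x"
        by (cases "F x") (simp_all add: u_def \<psi>_def amp_iter_minus)
      ultimately show "\<bar>(1 / 2) * (1 - \<psi> x) - of_bool (F x)\<bar> \<le> 1 / 3"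
        unfolding abs_le_iff by (cases "F x"; simp; linarith)
    qed
  qed simp
qed

subsection \<open>Parity as the outer function\<close>

lemma sum_Pow_power_card:
  fixes c :: real
  assumes "finite Z"
  shows "(\<Sum>T\<in>Pow Z. c ^ card T) = (c + 1) ^ card Z"
  using prod_add[OF assms, of "\<lambda>_. c" "\<lambda>_. 1"] by simp

lemma prod_if_power_card:
  fixes c :: real and n :: nat
  shows "(\<Prod>i<n. if P i then c else 1) = c ^ card {i. i < n \<and> P i}"
proof -
  have "(\<Prod>i<n. if P i then c else 1) = (\<Prod>i\<in>{..<n} \<inter> {i. P i}. c)"
    using prod.inter_restrict[OF finite_lessThan[of n], where g = "\<lambda>_. c" and B = "{i. P i}"] by simp
  also have "{..<n} \<inter> {i. P i} = {i. i < n \<and> P i}" by auto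
  finally show ?thesis by simp
qed

text \<open>The binomial expansion of \<open>(1 - 2) ^ card Z\<close> over subsets of
  \<open>Z\<close>, cut at size \<open>r\<close>. Nothing is cut if \<open>card Z \<le> r\<close>;
  in general absolute values sum to at most \<open>(1 + 2) ^ card Z\<close>.\<close>

lemma truncated_parity:
  fixes n r :: nat
  defines "Q \<equiv> \<lambda>Z. \<Sum>T\<in>{T. T \<subseteq> {..<n} \<and> card T \<le> r}. (-2) ^ card T * (of_bool (T \<subseteq> Z) :: real)"
  assumes Z: "Z \<subseteq> {..<n}"
  shows "card Z \<le> r \<Longrightarrow> Q Z = (-1) ^ card Z" "\<bar>Q Z\<bar> \<le> 3 ^ card Z"
proof -
  have fin: "finite Z" using Z by (rule finite_subset) simp
  have Q: "Q Z = (\<Sum>T\<in>{T. T \<subseteq> Z \<and> card T \<le> r}. (-2) ^ card T)"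
    unfolding Q_def using Z by (intro sum.mono_neutral_cong_right) auto
  show "Q Z = (-1) ^ card Z" if "card Z \<le> r"
  proof -
    have "{T. T \<subseteq> Z \<and> card T \<le> r} = Pow Z"
      using that card_mono[OF fin] by (auto intro: order_trans)
    then show ?thesis using sum_Pow_power_card[OF fin, of "-2"] by (simp add: Q)
  qed
  have "\<bar>Q Z\<bar> \<le> (\<Sum>T\<in>{T. T \<subseteq> Z \<and> card T \<le> r}. 2 ^ card T)"
    unfolding Q by (rule order_trans[OF sum_abs]) (simp add: power_abs)
  also have "\<dots> \<le> (\<Sum>T\<in>Pow Z. 2 ^ card T)"
    using fin by (intro sum_mono2) auto
  also have "\<dots> = 3 ^ card Z"
    using sum_Pow_power_card[OF fin, of 2] by simp
  finally show "\<bar>Q Z\<bar> \<le> 3 ^ card Z" .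
qed

text \<open>An approximant of smaller degree would be orthogonal to the corrected product
  \<open>\<Psi>\<close>, limiting the correlation of \<open>\<Psi>\<close> with the composition to
  \<open>2 / 3\<close> of its norm. The constant \<open>1 / 600\<close> keeps the uncorrected part
  too light for that.\<close>

lemma approx_degree_parity_outer_dual:
  assumes s: "\<bar>s\<bar> = 1" "\<And>x. x \<in> cube n \<Longrightarrow> sgnb (f x) = s * chi x" and n: "n > 0"
    and \<psi>: "pure_high m d \<psi>" "(\<Sum>u\<in>cube m. \<bar>\<psi> u\<bar>) = 1" "(\<Sum>u\<in>cube m. \<psi> u * sgnb (g u)) \<ge> 1 - 1 / 600"
  shows "(n - n div 2) * d \<le> approx_degree (n * m) (bcomp n m f g)"
proof (rule ccontr)
  define k where "k = approx_degree (n * m) (bcomp n m f g)"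
  define r where "r = n div 2"
  assume "\<not> ?thesis"
  then have k: "k < (n - r) * d" by (simp add: k_def r_def)
  obtain \<phi> where \<phi>: "bool_poly (n * m) k \<phi>"
    "\<And>x. x \<in> cube (n * m) \<Longrightarrow> \<bar>\<phi> x - of_bool (bcomp n m f g x)\<bar> \<le> 1 / 3"
    using approx_degree_attained[of "n * m" "bcomp n m f g"] unfolding k_def by blast
  define bad where "bad u \<longleftrightarrow> \<psi> u * sgnb (g u) < 0" for u
  define Z where "Z x = {i. i < n \<and> bad (blk m i x)}" for x
  define Q where "Q A = (\<Sum>T\<in>{T. T \<subseteq> {..<n} \<and> card T \<le> r}. (-2) ^ card T * (of_bool (T \<subseteq> A) :: real))" for A
  define P where "P x = (\<Prod>i<n. \<bar>\<psi> (blk m i x)\<bar>)" for x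
  define \<Psi> where "\<Psi> x = (\<Prod>i<n. \<psi> (blk m i x)) * Q (Z x)" for x
  \<comment> \<open>Bounds \<open>\<bar>\<Psi> x\<bar>\<close> at the points where the truncated
    expansion \<open>Q\<close> may fail to be exact.\<close>
  define W where "W x = P x * (3 ^ card (Z x) * of_bool (card (Z x) > r))" for x
  define h where "h x = sgnb (bcomp n m f g x)" for x
  have Zsub: "Z x \<subseteq> {..<n}" for x by (auto simp: Z_def)
  have Q: "card (Z x) \<le> r \<Longrightarrow> Q (Z x) = (-1) ^ card (Z x)" "\<bar>Q (Z x)\<bar> \<le> 3 ^ card (Z x)" for x
    using truncated_parity[OF Zsub[of x], of r] by (simp_all add: Q_def)
  have P0: "P x \<ge> 0" for x by (simp add: P_def prod_nonneg)

  have orth: "(\<Sum>x\<in>cube (n * m). \<Psi> x * \<theta> x) = 0" if \<theta>: "bool_poly (n * m) k \<theta>" for \<theta>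
  proof -
    \<comment> \<open>The term of \<open>Q\<close> for \<open>T\<close> spoils only the blocks in
      \<open>T\<close>; at least \<open>n - r\<close> blocks keep a plain \<open>\<psi>\<close>,
      enough for \<open>pure_high_blocks\<close>.\<close>
    let ?\<eta> = "\<lambda>T i u. if i \<in> T then \<psi> u * of_bool (bad u) else \<psi> u"
    have zero: "(\<Sum>x\<in>cube (n * m). (\<Prod>i<n. ?\<eta> T i (blk m i x)) * \<theta> x) = 0"
      if T: "T \<subseteq> {..<n}" "card T \<le> r" for T
    proof -
      have high: "pure_high (n * m) (card ({..<n} - T) * d) (\<lambda>x. \<Prod>i<n. ?\<eta> T i (blk m i x))"
        using \<psi>(1) by (intro pure_high_blocks) auto
      have less: "k < card ({..<n} - T) * d"
      proof -
        have "card ({..<n} - T) = n - card T"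
          using T(1) by (subst card_Diff_subset) (auto intro: finite_subset)
        then have "(n - r) * d \<le> card ({..<n} - T) * d" using T(2) by (intro mult_le_mono1) simp
        then show ?thesis using k by linarith
      qed
      show ?thesis by (rule pure_highD[OF high \<theta> less])
    qed
    have split: "(\<Prod>i<n. ?\<eta> T i (blk m i x)) = (\<Prod>i<n. \<psi> (blk m i x)) * of_bool (T \<subseteq> Z x)"
      if T: "T \<subseteq> {..<n}" for T x
    proof -
      have "(\<Prod>i<n. ?\<eta> T i (blk m i x))
          = (\<Prod>i<n. \<psi> (blk m i x) * of_bool (i \<in> T \<longrightarrow> bad (blk m i x)))"
        by (intro prod.cong) auto
      also have "\<dots> = (\<Prod>i<n. \<psi> (blk m i x)) * of_bool (\<forall>i\<in>{..<n}. i \<in> T \<longrightarrow> bad (blk m i x))"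
        by (simp add: prod.distrib of_bool_Ball)
      also have "(\<forall>i\<in>{..<n}. i \<in> T \<longrightarrow> bad (blk m i x)) \<longleftrightarrow> T \<subseteq> Z x"
        using T by (auto simp: Z_def)
      finally show ?thesis .
    qed
    have "(\<Sum>x\<in>cube (n * m). \<Psi> x * \<theta> x) = (\<Sum>x\<in>cube (n * m).
        \<Sum>T\<in>{T. T \<subseteq> {..<n} \<and> card T \<le> r}. (-2) ^ card T * ((\<Prod>i<n. ?\<eta> T i (blk m i x)) * \<theta> x))"
      unfolding \<Psi>_def Q_def sum_distrib_left sum_distrib_right
      by (intro sum.cong refl) (simp add: split mult_ac)
    also have "\<dots> = (\<Sum>T\<in>{T. T \<subseteq> {..<n} \<and> card T \<le> r}. \<Sum>x\<in>cube (n * m).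
        (-2) ^ card T * ((\<Prod>i<n. ?\<eta> T i (blk m i x)) * \<theta> x))"
      by (rule sum.swap)
    also have "\<dots> = 0"
    proof (rule sum.neutral, rule ballI)
      fix T assume "T \<in> {T. T \<subseteq> {..<n} \<and> card T \<le> r}"
      then have "(\<Sum>x\<in>cube (n * m). (\<Prod>i<n. ?\<eta> T i (blk m i x)) * \<theta> x) = 0"
        by (intro zero) simp_all
      then show "(\<Sum>x\<in>cube (n * m). (-2) ^ card T * ((\<Prod>i<n. ?\<eta> T i (blk m i x)) * \<theta> x)) = 0"
        by (simp only: sum_distrib_left[symmetric] mult_zero_right)
    qed
    finally show ?thesis .
  qed

  have sumP: "(\<Sum>x\<in>cube (n * m). P x) = 1"
    unfolding P_def using sum_cube_blocks[where f = "\<lambda>i u. \<bar>\<psi> u\<bar>"] \<psi>(2) by simp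

  \<comment> \<open>Exponential moment bound: \<open>card (Z x) > n div 2\<close> implies \<open>20 ^ n \<le> 400 ^ card (Z x)\<close>.\<close>
  have tail: "(\<Sum>x\<in>cube (n * m). W x) \<le> 1 / 10"
  proof -
    define p where "p = (\<Sum>u\<in>cube m. \<bar>\<psi> u\<bar> * of_bool (bad u))"
    \<comment> \<open>Bad points count negatively, so a correlation of at least
      \<open>1 - 1 / 600\<close> leaves them mass at most \<open>1 / 1200\<close>.\<close>
    have "\<psi> u * sgnb (g u) = \<bar>\<psi> u\<bar> - 2 * (\<bar>\<psi> u\<bar> * of_bool (bad u))" for u
      by (cases "g u") (auto simp: bad_def)
    then have "(\<Sum>u\<in>cube m. \<psi> u * sgnb (g u)) = 1 - 2 * p"
      by (simp add: p_def sum_subtractf \<psi>(2) flip: sum_distrib_left)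
    then have p: "p \<le> 1 / 1200" using \<psi>(3) by simp
    \<comment> \<open>The base \<open>1200\<close> is \<open>400 * 3\<close>: the moment base times
      the base in the bound on \<open>Q\<close>. It keeps the block factor
      \<open>1 + 1199 * p\<close> below \<open>2\<close>.\<close>
    have "20 ^ n * W x \<le> P x * 1200 ^ card (Z x)" for x
    proof (cases "card (Z x) > r")
      case True
      then have "n \<le> 2 * card (Z x)" by (simp add: r_def)
      then have "(20::real) ^ n \<le> 20 ^ (2 * card (Z x))" by (rule power_increasing) simp
      also have "\<dots> = 400 ^ card (Z x)" by (simp add: power_mult)
      finally have "(20::real) ^ n * 3 ^ card (Z x) \<le> 400 ^ card (Z x) * 3 ^ card (Z x)"
        by (rule mult_right_mono) simp
      also have "\<dots> = 1200 ^ card (Z x)" by (simp flip: power_mult_distrib)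
      finally have "P x * (20 ^ n * 3 ^ card (Z x)) \<le> P x * 1200 ^ card (Z x)"
        by (rule mult_left_mono[OF _ P0])
      then show ?thesis using True by (simp add: W_def mult_ac)
    qed (simp add: W_def P0)
    then have "(\<Sum>x\<in>cube (n * m). 20 ^ n * W x) \<le> (\<Sum>x\<in>cube (n * m). P x * 1200 ^ card (Z x))"
      by (intro sum_mono)
    also have "\<dots> = (\<Sum>x\<in>cube (n * m). \<Prod>i<n. \<bar>\<psi> (blk m i x)\<bar> * (if bad (blk m i x) then 1200 else 1))"
      by (simp add: P_def Z_def prod.distrib prod_if_power_card)
    also have "\<dots> = (\<Prod>i<n. \<Sum>u\<in>cube m. \<bar>\<psi> u\<bar> * (if bad u then 1200 else 1))"
      by (rule sum_cube_blocks[where f = "\<lambda>i u. \<bar>\<psi> u\<bar> * (if bad u then 1200 else 1)"])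
    also have "\<dots> = (1 + 1199 * p) ^ n"
    proof -
      have "\<bar>\<psi> u\<bar> * (if bad u then 1200 else 1) = \<bar>\<psi> u\<bar> + 1199 * (\<bar>\<psi> u\<bar> * of_bool (bad u))" for u
        by simp
      then have "(\<Sum>u\<in>cube m. \<bar>\<psi> u\<bar> * (if bad u then 1200 else 1)) = 1 + 1199 * p"
        by (simp only: sum.distrib \<psi>(2) p_def sum_distrib_left)
      then show ?thesis by simp
    qed
    also have "\<dots> \<le> 2 ^ n"
    proof (rule power_mono)
      have "p \<ge> 0" unfolding p_def by (intro sum_nonneg) simp
      then show "0 \<le> 1 + 1199 * p" by simp
      show "1 + 1199 * p \<le> 2" using p by simp
    qed
    finally have "20 ^ n * (\<Sum>x\<in>cube (n * m). W x) \<le> 2 ^ n"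
      by (simp flip: sum_distrib_left)
    then have "(\<Sum>x\<in>cube (n * m). W x) \<le> 2 ^ n / 20 ^ n"
      by (simp add: pos_le_divide_eq mult.commute)
    also have "\<dots> = (1 / 10) ^ n" by (simp flip: power_divide)
    also have "\<dots> \<le> (1 / 10) ^ 1" using n by (intro power_decreasing) auto
    finally show ?thesis by simp
  qed

  \<comment> \<open>As \<open>f\<close> is a parity up to \<open>s\<close>, each bad block
    contributes one wrong sign, which \<open>Q\<close> is there to undo.\<close>
  have sgn: "\<Psi> x * h x = s * (P x * ((-1) ^ card (Z x) * Q (Z x)))" if x: "x \<in> cube (n * m)" for x
  proof -
    have "h x = s * (\<Prod>i<n. sgnb (g (blk m i x)))"
      unfolding h_def by (simp add: bcomp_blk s(2) cube_def chi_map)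
    moreover have "(\<Prod>i<n. \<psi> (blk m i x)) * (\<Prod>i<n. sgnb (g (blk m i x)))
        = (\<Prod>i<n. \<bar>\<psi> (blk m i x)\<bar> * (if bad (blk m i x) then - 1 else 1))"
      unfolding prod.distrib[symmetric]
    proof (intro prod.cong refl)
      fix i
      show "\<psi> (blk m i x) * sgnb (g (blk m i x)) = \<bar>\<psi> (blk m i x)\<bar> * (if bad (blk m i x) then - 1 else 1)"
        by (cases "g (blk m i x)") (auto simp: bad_def)
    qed
    moreover have "\<dots> = P x * (-1) ^ card (Z x)"
      by (simp only: prod.distrib prod_if_power_card P_def Z_def)
    ultimately show ?thesis by (simp add: \<Psi>_def mult_ac)
  qed
  have absPsi: "\<bar>\<Psi> x\<bar> = P x * \<bar>Q (Z x)\<bar>" for x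
    by (simp add: \<Psi>_def P_def abs_mult abs_prod)

  define M where "M = (\<Sum>x\<in>cube (n * m). P x * \<bar>Q (Z x)\<bar>)"
  define E where "E = (\<Sum>x\<in>cube (n * m). P x * ((-1) ^ card (Z x) * Q (Z x)))"
  \<comment> \<open>With at most \<open>r\<close> bad blocks the corrected sign is right and
    \<open>\<bar>Q (Z x)\<bar> = 1\<close>. Otherwise both \<open>P x\<close> and
    \<open>P x * \<bar>Q (Z x)\<bar>\<close> are at most \<open>W x\<close>.\<close>
  have pt: "P x * \<bar>Q (Z x)\<bar> - 2 * W x \<le> P x * ((-1) ^ card (Z x) * Q (Z x))
      \<and> P x - W x \<le> P x * \<bar>Q (Z x)\<bar>" for x
  proof (cases "card (Z x) \<le> r")
    case True
    then show ?thesis by (simp add: Q(1) W_def power_abs flip: power_mult_distrib)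
  next
    case False
    have W: "W x = P x * 3 ^ card (Z x)" using False by (simp add: W_def)
    have "P x * \<bar>Q (Z x)\<bar> \<le> W x" unfolding W using Q(2) P0 by (rule mult_left_mono)
    moreover have "P x * 1 \<le> W x" unfolding W using P0 by (intro mult_left_mono) simp_all
    moreover have "\<bar>P x * ((-1) ^ card (Z x) * Q (Z x))\<bar> = P x * \<bar>Q (Z x)\<bar>"
      using P0 by (simp add: abs_mult power_abs)
    moreover have "P x * \<bar>Q (Z x)\<bar> \<ge> 0" using P0 by simp
    ultimately show ?thesis by linarith
  qed
  have "M - 2 * (\<Sum>x\<in>cube (n * m). W x) = (\<Sum>x\<in>cube (n * m). P x * \<bar>Q (Z x)\<bar> - 2 * W x)"
    by (simp add: M_def sum_subtractf sum_distrib_left)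
  also have "\<dots> \<le> E" unfolding E_def using pt by (intro sum_mono) blast
  finally have E: "E \<ge> M - 2 / 10" using tail by linarith
  have "1 - (\<Sum>x\<in>cube (n * m). W x) = (\<Sum>x\<in>cube (n * m). P x - W x)"
    by (simp add: sumP sum_subtractf)
  also have "\<dots> \<le> M" unfolding M_def using pt by (intro sum_mono) blast
  finally have M: "M \<ge> 9 / 10" using tail by linarith

  \<comment> \<open>The sign form of \<open>\<phi>\<close> has error \<open>2 / 3\<close> and is
    orthogonal to \<open>\<Psi>\<close>. The resulting \<open>E \<le> M * (2 / 3)\<close>
    contradicts \<open>E \<ge> M - 2 / 10\<close> and \<open>M \<ge> 9 / 10\<close>.\<close>
  have "bool_poly (n * m) k (\<lambda>x. 1 - 2 * \<phi> x)"
    by (intro bool_poly_diff bool_poly_const bool_poly.scale \<phi>(1))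
  from orth[OF this] have "(\<Sum>x\<in>cube (n * m). \<Psi> x * h x)
      = (\<Sum>x\<in>cube (n * m). \<Psi> x * (h x - (1 - 2 * \<phi> x)))"
    by (simp only: right_diff_distrib sum_subtractf diff_zero)
  moreover have "(\<Sum>x\<in>cube (n * m). \<Psi> x * h x) = s * E"
    unfolding E_def sum_distrib_left by (intro sum.cong refl sgn)
  ultimately have "\<bar>s * E\<bar> = \<bar>\<Sum>x\<in>cube (n * m). \<Psi> x * (h x - (1 - 2 * \<phi> x))\<bar>" by simp
  also have "\<dots> \<le> (\<Sum>x\<in>cube (n * m). P x * \<bar>Q (Z x)\<bar> * (2 / 3))"
  proof (rule order_trans[OF sum_abs], rule sum_mono)
    fix x assume "x \<in> cube (n * m)"
    note close = \<phi>(2)[OF this]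
    have "h x - (1 - 2 * \<phi> x) = 2 * (\<phi> x - of_bool (bcomp n m f g x))"
      by (simp add: h_def sgnb_def)
    then have "\<bar>h x - (1 - 2 * \<phi> x)\<bar> = 2 * \<bar>\<phi> x - of_bool (bcomp n m f g x)\<bar>"
      by (simp only: abs_mult abs_numeral)
    also have "\<dots> \<le> 2 * (1 / 3)" using close by (rule mult_left_mono) simp
    finally have "\<bar>h x - (1 - 2 * \<phi> x)\<bar> \<le> 2 / 3" by simp
    then show "\<bar>\<Psi> x * (h x - (1 - 2 * \<phi> x))\<bar> \<le> P x * \<bar>Q (Z x)\<bar> * (2 / 3)"
      unfolding abs_mult absPsi using P0 by (intro mult_left_mono) simp_all
  qed
  also have "\<dots> = M * (2 / 3)" by (simp only: M_def sum_distrib_right)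
  finally have "E \<le> M * (2 / 3)" using s(1) by (simp add: abs_mult)
  then show False using E M by linarith
qed

text \<open>Applies the dual bound at \<open>d\<close>, the least degree that approximates the sign
  of \<open>g\<close> with error \<open>1 - 1 / 600\<close>. Amplification costs the factor
  \<open>K\<close>, and the \<open>2\<close> comes from
  \<open>n \<le> 2 * (n - n div 2)\<close>.\<close>

lemma approx_degree_parity_outer:
  "\<exists>K>0. \<forall>n m s f g. \<bar>s\<bar> = 1 \<longrightarrow> (\<forall>x\<in>cube n. sgnb (f x) = s * chi x) \<longrightarrow>
    n * approx_degree m g \<le> 2 * K * approx_degree (n * m) (bcomp n m f g)"
proof -
  define \<delta> :: real where "\<delta> = 1 / 600"
  obtain K :: nat where K: "K > 0"
    "\<forall>n k \<phi> F. bool_poly n k \<phi> \<longrightarrow>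
      (\<forall>x\<in>cube n. \<bar>\<phi> x - sgnb (F x)\<bar> \<le> 1 - \<delta>) \<longrightarrow> approx_degree n F \<le> K * k"
    using approx_degree_amplify[of \<delta>] unfolding \<delta>_def by auto
  show ?thesis
  proof (rule exI[of _ K], intro conjI allI impI)
    show "K > 0" by (rule K(1))
    fix n m s f g
    assume s: "\<bar>s\<bar> = 1" "\<forall>x\<in>cube n. sgnb (f x) = s * chi x"
    let ?R = "\<lambda>k. \<exists>\<phi>. bool_poly m k \<phi> \<and> (\<forall>x\<in>cube m. \<bar>\<phi> x - sgnb (g x)\<bar> \<le> 1 - \<delta>)"
    define d where "d = (LEAST k. ?R k)"
    have "?R m"
      using bool_poly_full[of m "\<lambda>x. sgnb (g x)"] by (intro exI[of _ "\<lambda>x. sgnb (g x)"]) (simp add: \<delta>_def)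
    then have "?R d" unfolding d_def by (rule LeastI)
    then obtain \<phi> where \<phi>: "bool_poly m d \<phi>" "\<forall>x\<in>cube m. \<bar>\<phi> x - sgnb (g x)\<bar> \<le> 1 - \<delta>" by blast
    have g: "approx_degree m g \<le> K * d"
      using K(2)[THEN spec, THEN spec, THEN spec, THEN spec, of m d \<phi> g] \<phi> by simp
    show "n * approx_degree m g \<le> 2 * K * approx_degree (n * m) (bcomp n m f g)"
    proof (cases "n = 0 \<or> d = 0")
      \<comment> \<open>The left side is \<open>0\<close>: for \<open>d = 0\<close>, amplification
        bounds \<open>approx_degree m g\<close> by \<open>0\<close>.\<close>
      case True
      then show ?thesis using g by auto
    next
      case False
      have no: "\<forall>k<d. \<forall>\<phi>. bool_poly m k \<phi> \<longrightarrow> (\<exists>x\<in>cube m. \<bar>\<phi> x - sgnb (g x)\<bar> \<ge> 1 - \<delta>)"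
      proof (intro allI impI, rule ccontr)
        fix k \<phi> assume that: "bool_poly m k \<phi>" "k < d"
        assume "\<not> (\<exists>x\<in>cube m. \<bar>\<phi> x - sgnb (g x)\<bar> \<ge> 1 - \<delta>)"
        then have "\<forall>x\<in>cube m. \<bar>\<phi> x - sgnb (g x)\<bar> \<le> 1 - \<delta>" by (simp add: not_le less_imp_le)
        then have "?R k" using that(1) by blast
        then show False using not_less_Least[of k ?R] that(2) unfolding d_def by blast
      qed
      have "d > 0" "1 - \<delta> > 0" using False by (simp_all add: \<delta>_def)
      then obtain \<psi> where \<psi>: "pure_high m d \<psi>" "(\<Sum>x\<in>cube m. \<bar>\<psi> x\<bar>) = 1"
        "(\<Sum>x\<in>cube m. \<psi> x * sgnb (g x)) \<ge> 1 - \<delta>"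
        using approx_dual[OF abs_sgnb _ _ no] by blast
      have low: "(n - n div 2) * d \<le> approx_degree (n * m) (bcomp n m f g)"
        using s(2) False
        by (intro approx_degree_parity_outer_dual[OF s(1) _ _ \<psi>[unfolded \<delta>_def]]) simp_all
      have "n * approx_degree m g \<le> (2 * (n - n div 2)) * (K * d)"
        using g by (intro mult_le_mono) linarith+
      also have "\<dots> = 2 * K * ((n - n div 2) * d)" by (simp add: mult_ac)
      also have "\<dots> \<le> 2 * K * approx_degree (n * m) (bcomp n m f g)"
        using low by (rule mult_le_mono2)
      finally show ?thesis .
    qed
  qed
qed

section \<open>Powers of \<open>Amp\<close> as outer or inner function\<close>

theorem theorem26:
  shows "\<exists>C c :: real. C > 0 \<and> c > 0 \<and>
    (\<forall>(n::nat) (m::nat) (t::nat) (d::nat)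
       (f :: bool list \<Rightarrow> bool) (g :: bool list \<Rightarrow> bool) (Amp :: bool list \<Rightarrow> bool).
       real t \<ge> C * log 2 (real n) \<longrightarrow>
       sign_degree t Amp = t \<longrightarrow>
       d \<ge> 1 \<longrightarrow>
       (n = t ^ d \<and> (\<forall>x\<in>cube n. f x = bpow t Amp d x)) \<or>
       (m = t ^ d \<and> (\<forall>x\<in>cube m. g x = bpow t Amp d x)) \<longrightarrow>
       real (approx_degree (n * m) (bcomp n m f g))
         \<ge> c * real (approx_degree n f) * real (approx_degree m g))"
proof -
  obtain K :: nat where K: "K > 0"
    "\<forall>n m s f g. \<bar>s\<bar> = 1 \<longrightarrow> (\<forall>x\<in>cube n. sgnb (f x) = s * chi x) \<longrightarrow>
      n * approx_degree m g \<le> 2 * K * approx_degree (n * m) (bcomp n m f g)"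
    using approx_degree_parity_outer by blast
  show ?thesis
  proof (rule exI[of _ 1], rule exI[of _ "1 / (2 * real K)"], intro conjI allI impI)
    show "0 < 1 / (2 * real K)" using K(1) by simp
    fix n m t d f g Amp
    assume Amp: "sign_degree t Amp = t"
      and fg: "(n = t ^ d \<and> (\<forall>x\<in>cube n. f x = bpow t Amp d x)) \<or>
       (m = t ^ d \<and> (\<forall>x\<in>cube m. g x = bpow t Amp d x))"
    let ?A = "approx_degree (n * m) (bcomp n m f g)"
    obtain s where "\<bar>s\<bar> = 1" "\<And>x. x \<in> cube t \<Longrightarrow> sgnb (Amp x) = s * chi x"
      using full_sign_degree_imp_parity[OF Amp] by blast
    from bpow_parity[OF this] obtain s' where s': "\<bar>s'\<bar> = 1"
      "\<And>x. x \<in> cube (t ^ d) \<Longrightarrow> sgnb (bpow t Amp d x) = s' * chi x" by blast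
    \<comment> \<open>The parity function is bounded by its arity, which turns the product into the
      left side of the matching parity lemma.\<close>
    have "approx_degree n f * approx_degree m g \<le> 2 * K * ?A"
      using fg
    proof
      assume f: "n = t ^ d \<and> (\<forall>x\<in>cube n. f x = bpow t Amp d x)"
      have "approx_degree n f * approx_degree m g \<le> n * approx_degree m g"
        by (intro mult_le_mono1 approx_degree_le_arity)
      also have "\<dots> \<le> 2 * K * ?A" using f s' by (intro K(2)[rule_format, of s']) simp_all
      finally show ?thesis .
    next
      assume g: "m = t ^ d \<and> (\<forall>x\<in>cube m. g x = bpow t Amp d x)"
      have "approx_degree n f * approx_degree m g \<le> approx_degree n f * m"
        by (intro mult_le_mono2 approx_degree_le_arity)
      also have "\<dots> \<le> ?A"
      \<comment> \<open>\<open>approx_degree_parity_inner\<close> requires \<open>m > 0\<close>; for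
        \<open>m = 0\<close> the product is \<open>0\<close>.\<close>
      proof (cases "m = 0")
        case False
        then show ?thesis
          using g s' approx_degree_parity_inner[of s' m g n f] by (simp add: mult.commute)
      qed simp
      also have "\<dots> \<le> 2 * K * ?A" using K(1) by simp
      finally show ?thesis .
    qed
    then have "real (approx_degree n f * approx_degree m g) \<le> real (2 * K * ?A)"
      by (rule of_nat_mono)
    then show "1 / (2 * real K) * real (approx_degree n f) * real (approx_degree m g) \<le> real ?A"
      using K(1) by (simp add: field_simps)
  qed simp
qed

end
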